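(* Let $n\ge 2$, let $\delta=\sum_{i=1}^n\varepsilon_i\,dx_i\otimes dx_i$ with $\varepsilon_i=\pm1$ be a pseudo-Euclidean metric on $\mathbb{R}^n$, and let $r(x)=\sum_{i=1}^n\varepsilon_ix_i^2$. Let $\varphi,f:(a,b)\subset\mathbb{R}\to\mathbb{R}$ be smooth functions with $\varphi>0$, and consider the compositions $\varphi(r)=\varphi\circ r$ and $f(r)=f\circ r$ on $r^{-1}(a,b)\subset\mathbb{R}^n$. Then $\delta\varphi^{-2}$ is a gradient $k$-Yamabe soliton with $f$ as potential function (and soliton constant $\lambda$) if, and only if, $\varphi$ and $f$ satisfy $$f''+2\frac{f'\varphi'}{\varphi}=0$$ and $$c_{n,k}\left[\varphi\varphi'-r(\varphi')^2\right]^{k-1}\left(2n\varphi\varphi'-2nr(\varphi')^2+4kr\varphi\varphi''\right)-\frac{\varphi^2f'}{n-1}+\frac{2rf'\varphi'\varphi}{n-1}=\lambda,$$ where $$c_{n,k}=\frac{(n-1)!}{k!(n-k)!}2^{k-1}.$$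
   Context: A pseudo-Riemannian manifold $(M^n,g)$ is a gradient $k$-Yamabe soliton ($1\le k\le n$) if there are a constant $\lambda\in\mathbb{R}$ (the soliton constant) and a function $f\in C^\infty(M)$ (the potential function) with $\nabla^2 f=2(n-1)(\sigma_k-\lambda)g$, where $\nabla^2 f$ is the Hessian of $f$ with respect to $g$ and $\sigma_k$ is the $k$-th elementary symmetric function of the eigenvalues of $g^{-1}A_g$. Here $A_g=\frac1{n-2}\left[Ric_g-\frac{scal_g}{2(n-1)}g\right]$ is the Schouten tensor; for a conformal metric $g=\delta/\varphi^2$ it is computed as $A_g=\frac{\nabla^2_\delta\varphi}{\varphi}-\frac{|\nabla_\delta\varphi|^2}{2\varphi^2}\delta$. Primes denote derivatives with respect to $r$.
   Formalization: The two equations are required only at values of r in (a,b) attained by r(x) on R^n, not on all of (a,b); for definite δ the "only if" fails at unattained values (φ=1, f flat for r≥0 but nonzero for r<0). For indefinite δ nothing changes. *)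

theory Defs
  imports "HOL-Analysis.Analysis" "HOL-Computational_Algebra.Computational_Algebra"
begin

section \<open>Partial derivatives and smooth functions\<close>

definition partial_deriv :: "'a::real_normed_vector \<Rightarrow> ('a \<Rightarrow> real) \<Rightarrow> 'a \<Rightarrow> real" where
  "partial_deriv v F x = deriv (\<lambda>t. F (x + t *\<^sub>R v)) 0"

text \<open>
  On an open set this is the usual class of \<open>m\<close> times continuously differentiable functions.
  For \<open>'a = real\<close> the only basis vector is \<open>1\<close>, and the iterated partial derivatives are the
  ordinary ones.
\<close>
primrec C_diff_on :: "nat \<Rightarrow> 'a::euclidean_space set \<Rightarrow> ('a \<Rightarrow> real) \<Rightarrow> bool" where
  "C_diff_on 0 S F \<longleftrightarrow> continuous_on S F"
| "C_diff_on (Suc m) S F \<longleftrightarrow>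
     F differentiable_on S \<and> (\<forall>b\<in>Basis. C_diff_on m S (partial_deriv b F))"

definition smooth_on :: "'a::euclidean_space set \<Rightarrow> ('a \<Rightarrow> real) \<Rightarrow> bool" where
  "smooth_on S F \<longleftrightarrow> (\<forall>m. C_diff_on m S F)"

abbreviation pd :: "'n::finite \<Rightarrow> (real^'n \<Rightarrow> real) \<Rightarrow> real^'n \<Rightarrow> real" where
  "pd i \<equiv> partial_deriv (axis i 1)"


section \<open>Pseudo-Riemannian metrics on open subsets of \<open>\<real>\<^sup>n\<close>\<close>

text \<open>
  A metric is given by its matrix \<open>g x $ i $ j\<close> in the standard coordinates. By continuity,
  nondegeneracy makes the signature constant on every connected component.
\<close>
definition pseudo_riemannian_metric :: "(real^'n) set \<Rightarrow> (real^'n \<Rightarrow> real^'n^'n) \<Rightarrow> bool" where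
  "pseudo_riemannian_metric M g \<longleftrightarrow>
     open M \<and> (\<forall>i j. smooth_on M (\<lambda>x. g x $ i $ j)) \<and>
     (\<forall>x\<in>M. transpose (g x) = g x \<and> invertible (g x))"

definition christoffel :: "(real^'n \<Rightarrow> real^'n^'n) \<Rightarrow> 'n \<Rightarrow> 'n \<Rightarrow> 'n \<Rightarrow> real^'n \<Rightarrow> real" where
  "christoffel g k i j x =
     (\<Sum>l\<in>UNIV. matrix_inv (g x) $ k $ l *
        (pd i (\<lambda>y. g y $ j $ l) x + pd j (\<lambda>y. g y $ i $ l) x - pd l (\<lambda>y. g y $ i $ j) x)) / 2"

definition hessian :: "(real^'n \<Rightarrow> real^'n^'n) \<Rightarrow> (real^'n \<Rightarrow> real) \<Rightarrow> real^'n \<Rightarrow> real^'n^'n" where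
  "hessian g F x =
     (\<chi> i j. pd i (pd j F) x - (\<Sum>k\<in>UNIV. christoffel g k i j x * pd k F x))"

definition grad_norm_sq :: "(real^'n \<Rightarrow> real^'n^'n) \<Rightarrow> (real^'n \<Rightarrow> real) \<Rightarrow> real^'n \<Rightarrow> real" where
  "grad_norm_sq g F x = (\<Sum>i\<in>UNIV. \<Sum>j\<in>UNIV. matrix_inv (g x) $ i $ j * pd i F x * pd j F x)"

text \<open>The sign convention is the one for which the round sphere has positive Ricci tensor.\<close>
definition ricci :: "(real^'n \<Rightarrow> real^'n^'n) \<Rightarrow> real^'n \<Rightarrow> real^'n^'n" where
  "ricci g x =
     (\<chi> i j. \<Sum>k\<in>UNIV. pd k (christoffel g k i j) x - pd j (christoffel g k i k) x +
        (\<Sum>l\<in>UNIV. christoffel g k k l x * christoffel g l i j x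
                   - christoffel g k j l x * christoffel g l i k x))"

definition scal :: "(real^'n \<Rightarrow> real^'n^'n) \<Rightarrow> real^'n \<Rightarrow> real" where
  "scal g x = (\<Sum>i\<in>UNIV. \<Sum>j\<in>UNIV. matrix_inv (g x) $ i $ j * ricci g x $ i $ j)"

definition schouten :: "(real^'n \<Rightarrow> real^'n^'n) \<Rightarrow> real^'n \<Rightarrow> real^'n^'n" where
  "schouten g x =
     (1 / (real CARD('n) - 2)) *\<^sub>R
       (ricci g x - (scal g x / (2 * (real CARD('n) - 1))) *\<^sub>R g x)"


section \<open>Metrics conformal to a pseudo-Euclidean metric\<close>

definition pseudo_euclidean :: "('n \<Rightarrow> real) \<Rightarrow> real^'n^'n" where
  "pseudo_euclidean \<epsilon> = (\<chi> i j. if i = j then \<epsilon> i else 0)"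

definition conformal_metric :: "real^'n^'n \<Rightarrow> (real^'n \<Rightarrow> real) \<Rightarrow> real^'n \<Rightarrow> real^'n^'n" where
  "conformal_metric \<delta> \<phi> x = (1 / (\<phi> x)\<^sup>2) *\<^sub>R \<delta>"

text \<open>
  In dimension 2 the intrinsic formula for the Schouten tensor divides by \<open>n - 2 = 0\<close>. For the
  metric \<open>\<delta>/\<phi>\<^sup>2\<close> the formula
  \<open>A = \<nabla>\<^sup>2\<phi>/\<phi> - |\<nabla>\<phi>|\<^sup>2/(2\<phi>\<^sup>2) \<delta>\<close>, with the Hessian and the gradient norm taken with
  respect to \<open>\<delta>\<close>, is a theorem for \<open>n \<ge> 3\<close> and serves as the definition for \<open>n = 2\<close>.
\<close>
definition schouten_conformal :: "real^'n^'n \<Rightarrow> (real^'n \<Rightarrow> real) \<Rightarrow> real^'n \<Rightarrow> real^'n^'n" where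
  "schouten_conformal \<delta> \<phi> x =
     (if CARD('n) = 2
      then (1 / \<phi> x) *\<^sub>R hessian (\<lambda>_. \<delta>) \<phi> x
             - (grad_norm_sq (\<lambda>_. \<delta>) \<phi> x / (2 * (\<phi> x)\<^sup>2)) *\<^sub>R \<delta>
      else schouten (conformal_metric \<delta> \<phi>) x)"


section \<open>Elementary symmetric functions of eigenvalues\<close>

definition char_polynomial :: "complex^'n^'n \<Rightarrow> complex poly" where
  "char_polynomial A = det (\<chi> i j. (if i = j then [:0, 1:] else 0) - [:A $ i $ j:])"

text \<open>
  The complex eigenvalues with algebraic multiplicity: \<open>g\<inverse>A\<close> need not be diagonalizable over the
  reals when \<open>g\<close> is indefinite.
\<close>
definition eigenvalues :: "real^'n^'n \<Rightarrow> complex multiset" where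
  "eigenvalues A = proots (char_polynomial (\<chi> i j. complex_of_real (A $ i $ j)))"

text \<open>The pair \<open>(z, i)\<close> stands for the \<open>i\<close>-th copy of \<open>z\<close> in the multiset.\<close>
definition elem_sym :: "nat \<Rightarrow> complex multiset \<Rightarrow> complex" where
  "elem_sym k X = (\<Sum>S | S \<subseteq> {(z, i). i < count X z} \<and> card S = k. \<Prod>(z, i)\<in>S. z)"

text \<open>
  Nonreal eigenvalues of a real matrix occur in conjugate pairs, so the symmetric function is real
  and \<open>Re\<close> only changes the type.
\<close>
definition sigma :: "nat \<Rightarrow> real^'n^'n \<Rightarrow> real" where
  "sigma k A = Re (elem_sym k (eigenvalues A))"


section \<open>Gradient \<open>k\<close>-Yamabe solitons\<close>

text \<open>
  \<open>A\<close> is the Schouten tensor of \<open>g\<close>; it is a separate argument because of its special role in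
  dimension 2.
\<close>
definition gradient_k_yamabe_soliton ::
  "(real^'n) set \<Rightarrow> (real^'n \<Rightarrow> real^'n^'n) \<Rightarrow> (real^'n \<Rightarrow> real^'n^'n) \<Rightarrow> nat
     \<Rightarrow> (real^'n \<Rightarrow> real) \<Rightarrow> real \<Rightarrow> bool" where
  "gradient_k_yamabe_soliton M g A k F lam \<longleftrightarrow>
     pseudo_riemannian_metric M g \<and> smooth_on M F \<and>
     (\<forall>x\<in>M. hessian g F x =
        (2 * (real CARD('n) - 1) * (sigma k (matrix_inv (g x) ** A x) - lam)) *\<^sub>R g x)"

definition radial :: "('n::finite \<Rightarrow> real) \<Rightarrow> real^'n \<Rightarrow> real" where
  "radial \<epsilon> x = (\<Sum>i\<in>UNIV. \<epsilon> i * (x $ i)\<^sup>2)"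

definition c_const :: "nat \<Rightarrow> nat \<Rightarrow> real" where
  "c_const n k = fact (n - 1) / (fact k * fact (n - k)) * 2 ^ (k - 1)"

end

theory Submission
  imports Defs
begin

text \<open>
  Write \<open>r = \<Sum> \<epsilon>\<^sub>i x\<^sub>i\<^sup>2\<close> and \<open>\<xi>\<^sub>i = \<epsilon>\<^sub>i x\<^sub>i\<close>, so that \<open>\<partial>\<^sub>i r = 2 \<xi>\<^sub>i\<close>. For a function \<open>h\<close> of \<open>r\<close> the
  second derivatives are \<open>4 h'' \<xi>\<^sub>i \<xi>\<^sub>j + 2 h' \<delta>\<^sub>i\<^sub>j\<close>: a rank-one term plus a multiple of the flat metric
  \<open>\<delta>\<close>. Both sides of the soliton equation inherit this shape, and the two ordinary differential
  equations are the vanishing of the two coefficients.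

  For the left-hand side, the formula for the Hessian under the conformal change \<open>g = \<delta>/\<phi>\<^sup>2\<close>
  (\<open>hessian_conformal_metric\<close>) gives
  \<open>\<nabla>\<^sup>2f = 4 (f'' + 2 f' \<phi>'/\<phi>) \<xi>\<xi>\<^sup>T + (2 f' - 4 r f' \<phi>'/\<phi>) \<delta>\<close>. The right-hand side is a multiple of \<open>\<delta>\<close>
  whose factor contains \<open>\<sigma>\<^sub>k\<close>. The Schouten tensor is \<open>\<nabla>\<^sup>2\<phi>/\<phi> - |\<nabla>\<phi>|\<^sup>2/(2\<phi>\<^sup>2) \<delta>\<close>
  (\<open>schouten_conformal_metric\<close>, a computation of the Ricci tensor from the Christoffel symbols), so
  \<open>g\<inverse>A\<close> is \<open>\<mu>\<close> times the identity, with \<open>\<mu> = 2 (\<phi>\<phi>' - r \<phi>'\<^sup>2)\<close>, plus the rank-one matrix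
  \<open>4 \<phi>\<phi>'' x \<xi>\<^sup>T\<close>, of trace \<open>4 r \<phi>\<phi>''\<close>. Its eigenvalues are \<open>\<mu>\<close>, with multiplicity \<open>n - 1\<close>, and
  \<open>\<mu> + 4 r \<phi>\<phi>''\<close>. This remains true where \<open>\<xi>\<^sup>Tx = r = 0\<close> and the matrix need not be diagonalizable,
  because the characteristic polynomial only sees the determinant of a scalar matrix plus a
  rank-one matrix. Hence \<open>\<sigma>\<^sub>k\<close> is the expression with the constant \<open>c_const n k\<close>.

  What remains is to separate \<open>\<xi>\<xi>\<^sup>T\<close> from \<open>\<delta>\<close> (\<open>radial_rank_one_equation_iff\<close>). On a level set \<open>r \<noteq> 0\<close>
  some point has two nonzero coordinates, and the corresponding off-diagonal entry isolates the
  coefficient of \<open>\<xi>\<xi>\<^sup>T\<close>. In the definite case the level set \<open>r = 0\<close> is the origin alone, where \<open>\<xi>\<close>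
  vanishes; there the first equation comes from neighbouring values of \<open>r\<close> by continuity.
\<close>

(* The symbol $ selects a component of a vector here, not a coefficient of a power series. *)
unbundle no fps_syntax

section \<open>Partial derivatives and functions of class \<open>C\<^sup>m\<close>\<close>

lemma partial_derivI:
  "((\<lambda>t. F (x + t *\<^sub>R v)) has_real_derivative D) (at 0) \<Longrightarrow> partial_deriv v F x = D"
  unfolding partial_deriv_def by (rule DERIV_imp_deriv)

lemma has_partial_deriv:
  assumes "F differentiable at x"
  shows "((\<lambda>t. F (x + t *\<^sub>R v)) has_real_derivative partial_deriv v F x) (at 0)"
proof -
  have "(\<lambda>t. F (x + t *\<^sub>R v)) differentiable at 0"
  proof (rule differentiable_compose[of F "\<lambda>t. x + t *\<^sub>R v"])
    show "F differentiable at (x + 0 *\<^sub>R v)" using assms by simp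
    show "(\<lambda>t. x + t *\<^sub>R v) differentiable at 0"
      unfolding differentiable_def by (auto intro!: derivative_eq_intros)
  qed
  then show ?thesis
    unfolding partial_deriv_def by (simp add: DERIV_deriv_iff_real_differentiable)
qed

lemma partial_deriv_cong:
  assumes "open S" "x \<in> S" "\<And>y. y \<in> S \<Longrightarrow> F y = G y"
  shows "partial_deriv v F x = partial_deriv v G x"
proof -
  have "((\<lambda>t. x + t *\<^sub>R v) \<longlongrightarrow> x + 0 *\<^sub>R v) (nhds 0)"
    by (intro tendsto_intros filterlim_ident)
  then have "\<forall>\<^sub>F t in nhds 0. x + t *\<^sub>R v \<in> S"
    using assms(1,2) by (simp add: tendsto_def)
  then have "\<forall>\<^sub>F t in nhds 0. F (x + t *\<^sub>R v) = G (x + t *\<^sub>R v)"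
    by eventually_elim (use assms(3) in auto)
  then show ?thesis
    unfolding partial_deriv_def by (intro deriv_cong_ev) auto
qed

lemma partial_deriv_const [simp]: "partial_deriv v (\<lambda>_. c) x = 0"
  by (rule partial_derivI) simp

lemma partial_deriv_add:
  assumes "F differentiable at x" "G differentiable at x"
  shows "partial_deriv v (\<lambda>y. F y + G y) x = partial_deriv v F x + partial_deriv v G x"
  by (rule partial_derivI) (intro DERIV_add has_partial_deriv assms)

lemma partial_deriv_mult:
  assumes "F differentiable at x" "G differentiable at x"
  shows "partial_deriv v (\<lambda>y. F y * G y) x = partial_deriv v F x * G x + F x * partial_deriv v G x"
  using DERIV_mult[OF has_partial_deriv[OF assms(1), of v] has_partial_deriv[OF assms(2), of v]]
  by (intro partial_derivI) (simp add: algebra_simps)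

lemma partial_deriv_cmult:
  assumes "F differentiable at x"
  shows "partial_deriv v (\<lambda>y. c * F y) x = c * partial_deriv v F x"
  by (rule partial_derivI) (intro DERIV_cmult has_partial_deriv assms)

lemma partial_deriv_compose:
  assumes "(g has_real_derivative D) (at (F x))" "F differentiable at x"
  shows "partial_deriv v (\<lambda>y. g (F y)) x = D * partial_deriv v F x"
proof (rule partial_derivI)
  have "(g has_real_derivative D) (at (F (x + 0 *\<^sub>R v)))" using assms(1) by simp
  from DERIV_chain2[OF this has_partial_deriv[OF assms(2)]]
  show "((\<lambda>t. g (F (x + t *\<^sub>R v))) has_real_derivative D * partial_deriv v F x) (at 0)" .
qed

lemma partial_deriv_inverse:
  assumes "F differentiable at x" "F x \<noteq> 0"
  shows "partial_deriv v (\<lambda>y. inverse (F y)) x =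
    - 1 * (partial_deriv v F x * (inverse (F x) * inverse (F x)))"
  by (subst partial_deriv_compose[where g = inverse, OF DERIV_inverse[OF assms(2)] assms(1)])
    (simp add: power2_eq_square)

text \<open>
  The class \<open>C\<^sup>m\<close> on the line is defined through partial derivatives along the basis vector \<open>1\<close>; this
  identifies them with ordinary derivatives.
\<close>
lemma partial_deriv_real [simp]: "partial_deriv 1 g = deriv (g :: real \<Rightarrow> real)"
proof
  fix t
  have "(g has_real_derivative D) (at t) \<longleftrightarrow> ((\<lambda>s. g (t + s)) has_real_derivative D) (at 0)" for D
    using DERIV_shift[of g D 0 t] by (simp add: add.commute)
  then show "partial_deriv 1 g t = deriv g t"
    by (simp add: partial_deriv_def deriv_def)
qed

text \<open>
  The closure properties below go by induction on \<open>m\<close>: a product, inverse or composition has partial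
  derivatives that are built from functions of class \<open>C\<^sup>m\<close>. The formulas for these derivatives hold
  on the open set only, which is why congruence on that set comes first.
\<close>
lemma C_diff_on_cong:
  assumes "open S" "\<And>x. x \<in> S \<Longrightarrow> F x = G x"
  shows "C_diff_on m S F \<longleftrightarrow> C_diff_on m S G"
  using assms(2)
proof (induction m arbitrary: F G)
  case 0
  then show ?case by (simp cong: continuous_on_cong)
next
  case (Suc m)
  have "F differentiable_on S \<longleftrightarrow> G differentiable_on S"
    using Suc.prems unfolding differentiable_on_def
    by (metis (mono_tags, lifting) differentiable_transform_within zero_less_one)
  moreover have "C_diff_on m S (partial_deriv b F) \<longleftrightarrow> C_diff_on m S (partial_deriv b G)" for b
    using Suc.prems by (intro Suc.IH partial_deriv_cong[OF assms(1)])
  ultimately show ?case by simp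
qed

lemma C_diff_on_Suc_imp: "C_diff_on (Suc m) S F \<Longrightarrow> C_diff_on m S F"
  by (induction m arbitrary: F) (auto simp: differentiable_imp_continuous_on)

lemma C_diff_on_Suc_iff:
  assumes "open S"
  shows "C_diff_on (Suc m) S F \<longleftrightarrow>
    (\<forall>x\<in>S. F differentiable at x) \<and> (\<forall>b\<in>Basis. C_diff_on m S (partial_deriv b F))"
  using assms by (simp add: differentiable_on_eq_differentiable_at)

lemma C_diff_on_const: "open S \<Longrightarrow> C_diff_on m S (\<lambda>_. c)"
proof (induction m arbitrary: c)
  case (Suc m)
  then have "C_diff_on m S (partial_deriv b (\<lambda>_. c))" for b
    by (subst C_diff_on_cong[where G = "\<lambda>_. 0"]) auto
  then show ?case by simp
qed auto

lemma C_diff_on_add: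
  assumes "open S" "C_diff_on m S F" "C_diff_on m S G"
  shows "C_diff_on m S (\<lambda>x. F x + G x)"
  using assms(2,3)
proof (induction m arbitrary: F G)
  case 0
  then show ?case by (auto intro: continuous_intros)
next
  case (Suc m)
  then show ?case
    unfolding C_diff_on_Suc_iff[OF assms(1)]
    by (auto simp: partial_deriv_add C_diff_on_cong[OF assms(1),
          of "partial_deriv _ (\<lambda>x. F x + G x)" "\<lambda>x. partial_deriv _ F x + partial_deriv _ G x"])
qed

lemma C_diff_on_sum:
  assumes "open S" "\<And>i. i \<in> I \<Longrightarrow> C_diff_on m S (F i)"
  shows "C_diff_on m S (\<lambda>x. \<Sum>i\<in>I. F i x)"
  using assms(2)
  by (induction I rule: infinite_finite_induct)
    (simp_all add: C_diff_on_const C_diff_on_add assms(1))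

lemma C_diff_on_mult:
  assumes "open S" "C_diff_on m S F" "C_diff_on m S G"
  shows "C_diff_on m S (\<lambda>x. F x * G x)"
  using assms(2,3)
proof (induction m arbitrary: F G)
  case 0
  then show ?case by (auto intro: continuous_intros)
next
  case (Suc m)
  have "C_diff_on m S (partial_deriv b (\<lambda>x. F x * G x))" if b: "b \<in> Basis" for b
  proof -
    have "C_diff_on m S (\<lambda>x. partial_deriv b F x * G x + F x * partial_deriv b G x)"
      using Suc.prems b Suc.prems[THEN C_diff_on_Suc_imp]
      by (intro C_diff_on_add Suc.IH assms(1)) simp_all
    then show ?thesis
      using Suc.prems unfolding C_diff_on_Suc_iff[OF assms(1)]
      by (subst C_diff_on_cong[OF assms(1)]) (auto intro: partial_deriv_mult)
  qed
  then show ?case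
    using Suc.prems unfolding C_diff_on_Suc_iff[OF assms(1)] by auto
qed

lemma C_diff_on_inverse:
  assumes "open S" "C_diff_on m S F" "\<And>x. x \<in> S \<Longrightarrow> F x \<noteq> 0"
  shows "C_diff_on m S (\<lambda>x. inverse (F x))"
  using assms(2)
proof (induction m)
  case 0
  then show ?case using assms(3) by (auto intro: continuous_intros)
next
  case (Suc m)
  have "C_diff_on m S (partial_deriv b (\<lambda>x. inverse (F x)))" if b: "b \<in> Basis" for b
  proof -
    have "C_diff_on m S (\<lambda>x. - 1 * (partial_deriv b F x * (inverse (F x) * inverse (F x))))"
      using Suc.prems b C_diff_on_Suc_imp[OF Suc.prems]
      by (intro C_diff_on_mult C_diff_on_const Suc.IH assms(1)) simp_all
    then show ?thesis
      using Suc.prems assms(3) unfolding C_diff_on_Suc_iff[OF assms(1)]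
      by (subst C_diff_on_cong[OF assms(1)]) (auto simp: partial_deriv_inverse)
  qed
  then show ?case
    using Suc.prems assms(3) unfolding C_diff_on_Suc_iff[OF assms(1)] by auto
qed

lemma C_diff_on_compose:
  fixes g :: "real \<Rightarrow> real"
  assumes "open S" "open T" "h ` S \<subseteq> T" "C_diff_on m S h" "C_diff_on m T g"
  shows "C_diff_on m S (\<lambda>x. g (h x))"
  using assms(4,5)
proof (induction m arbitrary: g)
  case 0
  then show ?case using assms(3) by (auto intro: continuous_on_compose2)
next
  case (Suc m)
  have h: "h differentiable at x" and g: "g differentiable at (h x)" if "x \<in> S" for x
    using Suc.prems that assms(3)
    unfolding C_diff_on_Suc_iff[OF assms(1)] C_diff_on_Suc_iff[OF assms(2)] by auto
  have "C_diff_on m S (partial_deriv b (\<lambda>x. g (h x)))" if b: "b \<in> Basis" for b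
  proof -
    have smooth: "C_diff_on m S (\<lambda>x. deriv g (h x) * partial_deriv b h x)"
    proof (rule C_diff_on_mult[OF assms(1)])
      show "C_diff_on m S (\<lambda>x. deriv g (h x))"
        using Suc.prems C_diff_on_Suc_imp[OF Suc.prems(1)] by (intro Suc.IH[of "deriv g"]) simp_all
      show "C_diff_on m S (partial_deriv b h)"
        using Suc.prems b by simp
    qed
    have chain: "partial_deriv b (\<lambda>x. g (h x)) x = deriv g (h x) * partial_deriv b h x"
      if "x \<in> S" for x
      by (rule partial_deriv_compose[where g = g])
        (simp_all add: DERIV_deriv_iff_real_differentiable h g that)
    from C_diff_on_cong[OF assms(1) chain] smooth show ?thesis by (rule iffD2)
  qed
  moreover have "(\<lambda>x. g (h x)) differentiable at x" if "x \<in> S" for x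
    using g[OF that] h[OF that] by (rule differentiable_compose)
  ultimately show ?case
    unfolding C_diff_on_Suc_iff[OF assms(1)] by blast
qed

lemma partial_deriv_component: "partial_deriv v (\<lambda>x. x $ i) x = v $ i" for v :: "real^'n"
  by (rule partial_derivI) (auto intro!: derivative_eq_intros)

lemma C_diff_on_component:
  assumes "open (S :: (real^'n::finite) set)"
  shows "C_diff_on m S (\<lambda>x. x $ i)"
proof (cases m)
  case 0
  then show ?thesis by (auto intro: continuous_intros)
next
  case (Suc m)
  have "partial_deriv b (\<lambda>x. x $ i) = (\<lambda>_. b $ i)" for b :: "real^'n"
    by (rule ext) (rule partial_deriv_component)
  then show ?thesis
    unfolding Suc C_diff_on_Suc_iff[OF assms]
    by (auto intro: C_diff_on_const[OF assms] bounded_linear_imp_differentiable bounded_linear_vec_nth)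
qed

section \<open>Elementary symmetric functions of a rank-one perturbation\<close>

lemma finite_copies: "finite {(z, i). i < count X z}"
proof -
  have "{(z, i). i < count X z} = (SIGMA z:set_mset X. {..<count X z})"
    by (auto intro: count_inI)
  then show ?thesis by simp
qed

lemma elem_sym_0 [simp]: "elem_sym 0 X = 1"
proof -
  have "{S. S \<subseteq> {(z, i). i < count X z} \<and> card S = 0} = {{}}"
    using finite_subset[OF _ finite_copies[of X]] by auto
  then show ?thesis by (simp add: elem_sym_def)
qed

lemma elem_sym_empty: "elem_sym (Suc k) {#} = 0"
  by (simp add: elem_sym_def)

text \<open>
  The new copy of \<open>z\<close> has index \<open>count X z\<close>. A \<open>(k + 1)\<close>-element set of copies either avoids it or is
  obtained by adding it to a \<open>k\<close>-element set of old copies.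
\<close>
lemma elem_sym_add_mset:
  "elem_sym (Suc k) (add_mset z X) = elem_sym (Suc k) X + z * elem_sym k X"
proof -
  let ?c = "(z, count X z)"
  let ?A = "{(w, i). i < count X w}"
  let ?P = "\<lambda>S. \<Prod>(w, i)\<in>S. w :: complex"
  let ?sub = "\<lambda>k. {S. S \<subseteq> ?A \<and> card S = k}"
  have fin: "finite ?A" by (rule finite_copies)
  have new: "?c \<notin> ?A" by simp
  have "{(w, i). i < count (add_mset z X) w} = insert ?c ?A"
    by (auto simp: less_Suc_eq split: if_splits)
  moreover have "{S. S \<subseteq> insert ?c ?A \<and> card S = Suc k} = ?sub (Suc k) \<union> insert ?c ` ?sub k"
    (is "?L = ?R")
  proof
    show "?L \<subseteq> ?R"
    proof
      fix S assume S: "S \<in> ?L"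
      then have finS: "finite S" using fin by (auto intro: finite_subset)
      show "S \<in> ?R"
      proof (cases "?c \<in> S")
        case True
        then have "S - {?c} \<in> ?sub k" "S = insert ?c (S - {?c})" using S finS by auto
        then show ?thesis by blast
      next
        case False
        then show ?thesis using S by auto
      qed
    qed
    have "card (insert ?c S) = Suc k" if "S \<in> ?sub k" for S
      using that new fin by (subst card_insert_disjoint) (auto intro: finite_subset)
    then show "?R \<subseteq> ?L" by blast
  qed
  moreover have "sum ?P (?sub (Suc k) \<union> insert ?c ` ?sub k) =
      sum ?P (?sub (Suc k)) + sum ?P (insert ?c ` ?sub k)"
    using fin new by (intro sum.union_disjoint) auto
  moreover have "sum ?P (insert ?c ` ?sub k) = sum (\<lambda>S. z * ?P S) (?sub k)"
  proof -
    have "inj_on (insert ?c) (?sub k)"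
    proof (rule inj_onI)
      fix S T assume "S \<in> ?sub k" "T \<in> ?sub k" "insert ?c S = insert ?c T"
      moreover from this have "?c \<notin> S" "?c \<notin> T" using new by auto
      ultimately show "S = T" using insert_ident[of ?c S T] by blast
    qed
    moreover have "?P (insert ?c S) = z * ?P S" if "S \<in> ?sub k" for S
      using that new fin by (subst prod.insert) (auto intro: finite_subset)
    ultimately show ?thesis by (simp add: sum.reindex)
  qed
  ultimately show ?thesis by (simp add: elem_sym_def sum_distrib_left)
qed

lemma elem_sym_replicate_mset:
  "elem_sym k (replicate_mset m z) = of_nat (m choose k) * z ^ k"
proof (induction m arbitrary: k)
  case 0
  then show ?case by (cases k) (simp_all add: elem_sym_empty)
next
  case (Suc m)
  show ?case
    by (cases k) (simp_all add: elem_sym_add_mset Suc algebra_simps)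
qed

text \<open>
  A permutation other than the identity moves an index besides \<open>j\<close>, and the diagonal row of that
  index contributes a zero factor.
\<close>
lemma det_diagonal_except_row:
  fixes c :: "'a::comm_ring_1" and v :: "'a^'n::finite"
  shows "det (\<chi> i. if i = j then v else c *s axis i 1) = c ^ (CARD('n) - 1) * v $ j"
proof -
  let ?A = "(\<chi> i. if i = j then v else c *s axis i 1) :: 'a^'n^'n"
  have "of_int (sign p) * (\<Prod>i\<in>UNIV. ?A $ i $ p i) = 0"
    if "p \<in> {p. p permutes UNIV} - {id}" for p :: "'n \<Rightarrow> 'n"
  proof -
    from that have p: "inj p" "p \<noteq> id" by (auto dest: permutes_inj)
    have "\<exists>i. i \<noteq> j \<and> p i \<noteq> i"
    proof (rule ccontr)
      assume "\<nexists>i. i \<noteq> j \<and> p i \<noteq> i"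
      then have fixed: "p i = i" if "i \<noteq> j" for i using that by blast
      have "p j = j"
      proof (rule ccontr)
        assume "p j \<noteq> j"
        then have "p (p j) = p j" by (rule fixed)
        with p(1) \<open>p j \<noteq> j\<close> show False by (simp add: inj_eq)
      qed
      with fixed have "p = id" by (metis eq_id_iff)
      with p(2) show False ..
    qed
    then obtain i where "i \<noteq> j" "p i \<noteq> i" by blast
    then have "?A $ i $ p i = 0" by (simp add: axis_def)
    then have "\<exists>i\<in>UNIV. ?A $ i $ p i = 0" by blast
    then have "(\<Prod>i\<in>UNIV. ?A $ i $ p i) = 0" by (rule prod_zero[OF finite])
    then show ?thesis by simp
  qed
  then have "det ?A = (\<Sum>p\<in>{id}. of_int (sign p) * (\<Prod>i\<in>UNIV. ?A $ i $ p i))"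
    unfolding det_def
    by (intro sum.mono_neutral_right) (auto simp: finite_permutations permutes_id)
  also have "\<dots> = (\<Prod>i\<in>UNIV. if i = j then v $ j else c)"
    by (auto simp: sign_id axis_def intro!: prod.cong)
  also have "\<dots> = (\<Prod>i\<in>insert j (UNIV - {j}). if i = j then v $ j else c)"
    by (simp add: insert_absorb)
  also have "\<dots> = v $ j * c ^ (CARD('n) - 1)"
    by (subst prod.insert) (auto simp: card_Diff_subset)
  finally show ?thesis by (simp add: mult.commute)
qed

text \<open>
  Adding multiples of row \<open>j\<close> to other rows does not change the determinant, so this reduces to the
  preceding lemma. The rows are treated one at a time, which works over any commutative ring; the
  ring needed later is that of polynomials.
\<close>
lemma det_rows_plus_multiples_of_row:
  fixes c :: "'a::comm_ring_1" and v :: "'a^'n::finite"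
  assumes "finite S" "j \<notin> S"
  shows "det (\<chi> i. if i = j then v else c *s axis i 1 + (if i \<in> S then u i *s v else 0)) =
    c ^ (CARD('n) - 1) * v $ j"
  using assms
proof (induction S)
  case empty
  show ?case using det_diagonal_except_row[of j v c] by (simp cong: if_cong)
next
  case (insert l S)
  let ?R = "\<lambda>S i. if i = j then v else c *s axis i 1 + (if i \<in> S then u i *s v else 0)"
  have lj: "l \<noteq> j" using insert by auto
  have "(\<chi> i. ?R (insert l S) i) = (\<chi> i. if i = l then ?R S i + u l *s v else ?R S i)"
    using insert lj by (auto simp: vec_eq_iff)
  moreover have "det (\<chi> i. if i = l then v else ?R S i) = 0"
    using lj by (intro det_identical_rows[of l j]) (auto simp: row_def)
  ultimately have "det (\<chi> i. ?R (insert l S) i) = det (\<chi> i. ?R S i)"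
    by (simp add: det_row_add det_row_mul) 
  then show ?case using insert by simp
qed

text \<open>
  Expand by multilinearity in the rows. A term in which two rows come from the rank-one part
  vanishes, and a term with exactly one such row \<open>u\<^sub>l v\<close> equals \<open>c\<^sup>n\<^sup>-\<^sup>1 u\<^sub>l v\<^sub>l\<close>. The induction admits the
  rank-one part into the rows of a growing set \<open>S\<close>.
\<close>
lemma det_scalar_plus_rank_one:
  fixes c :: "'a::comm_ring_1" and u v :: "'a^'n::finite"
  shows "det (\<chi> i j. (if i = j then c else 0) + u $ i * v $ j) =
    c ^ (CARD('n) - 1) * (c + (\<Sum>i\<in>UNIV. u $ i * v $ i))"
proof -
  let ?R = "\<lambda>S i::'n. c *s axis i 1 + (if i \<in> S then u $ i *s v else 0)"
  have "det (\<chi> i. ?R S i) = c ^ CARD('n) + c ^ (CARD('n) - 1) * (\<Sum>i\<in>S. u $ i * v $ i)"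
    if "finite S" for S
    using that
  proof (induction S)
    case empty
    have "det ((\<chi> i. c *s axis i 1) :: 'a^'n^'n) = (\<Prod>i\<in>(UNIV :: 'n set). c)"
      by (subst det_diagonal) (auto simp: axis_def)
    then show ?case by simp
  next
    case (insert l S)
    have "(\<chi> i. ?R (insert l S) i) = (\<chi> i. if i = l then ?R S i + u $ l *s v else ?R S i)"
      using insert by (auto simp: vec_eq_iff)
    moreover have "(\<chi> i. if i = l then ?R S i else ?R S i) = (\<chi> i. ?R S i)"
      by (simp add: vec_eq_iff)
    ultimately have "det (\<chi> i. ?R (insert l S) i) =
        det (\<chi> i. ?R S i) + u $ l * det (\<chi> i. if i = l then v else ?R S i)"
      by (simp add: det_row_add det_row_mul)
    also have "\<dots> = c ^ CARD('n) + c ^ (CARD('n) - 1) * (\<Sum>i\<in>S. u $ i * v $ i)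
        + u $ l * (c ^ (CARD('n) - 1) * v $ l)"
      using insert det_rows_plus_multiples_of_row[of S l v c "\<lambda>i. u $ i"] by simp
    finally show ?case using insert by (simp add: algebra_simps)
  qed
  from this[of UNIV] have "det (\<chi> i. ?R UNIV i) =
      c ^ CARD('n) + c ^ (CARD('n) - 1) * (\<Sum>i\<in>UNIV. u $ i * v $ i)"
    by simp
  moreover have "(\<chi> i. ?R UNIV i) = (\<chi> i j. (if i = j then c else 0) + u $ i * v $ j)"
    by (simp add: vec_eq_iff axis_def)
  moreover have "c ^ CARD('n) = c ^ (CARD('n) - 1) * c"
    by (metis power_minus_mult zero_less_card_finite)
  ultimately show ?thesis by (simp add: distrib_left)
qed

text \<open>
  The determinant formula over polynomials, with \<open>c = X - \<mu>\<close>, factors the characteristic polynomial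
  as \<open>(X - \<mu>)\<^sup>n\<^sup>-\<^sup>1 (X - \<mu> - v\<^sup>Tu)\<close>. No eigenvectors are involved, so \<open>v\<^sup>Tu = 0\<close> is allowed.
\<close>
lemma eigenvalues_scalar_plus_rank_one:
  fixes u v :: "real^'n::finite"
  shows "eigenvalues (\<chi> i j. (if i = j then \<mu> else 0) + u $ i * v $ j) =
    add_mset (of_real (\<mu> + (\<Sum>i\<in>UNIV. u $ i * v $ i)))
      (replicate_mset (CARD('n) - 1) (of_real \<mu>))"
proof -
  let ?s = "\<Sum>i\<in>UNIV. u $ i * v $ i"
  let ?u = "\<chi> i. [:- complex_of_real (u $ i):]" and ?v = "\<chi> i. [:complex_of_real (v $ i):]"
  have "char_polynomial (\<chi> i j. complex_of_real ((\<chi> i j. (if i = j then \<mu> else 0) + u $ i * v $ j) $ i $ j))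
      = det (\<chi> i j. (if i = j then [:- of_real \<mu>, 1:] else 0) + ?u $ i * ?v $ j)"
    unfolding char_polynomial_def by (intro arg_cong[where f = det]) (simp add: vec_eq_iff)
  also have "\<dots> = [:- of_real \<mu>, 1:] ^ (CARD('n) - 1) *
      ([:- of_real \<mu>, 1:] + (\<Sum>i\<in>UNIV. ?u $ i * ?v $ i))"
    by (rule det_scalar_plus_rank_one)
  also have "(\<Sum>i\<in>UNIV. ?u $ i * ?v $ i) = (\<Sum>i\<in>UNIV. [:- complex_of_real (u $ i * v $ i):])"
    by (simp add: mult.commute)
  also have "\<dots> = [:- complex_of_real ?s:]"
  proof -
    have "(\<Sum>i\<in>A. [:- complex_of_real (u $ i * v $ i):]) = [:- complex_of_real (\<Sum>i\<in>A. u $ i * v $ i):]"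
      if "finite A" for A
      using that by (induction A) auto
    then show ?thesis by simp
  qed
  also have "[:- of_real \<mu>, 1:] + [:- complex_of_real ?s:] = [:- of_real (\<mu> + ?s), 1:]"
    by simp
  finally have "eigenvalues (\<chi> i j. (if i = j then \<mu> else 0) + u $ i * v $ j) =
      proots ([:- of_real \<mu>, 1:] ^ (CARD('n) - 1) * [:- of_real (\<mu> + ?s), 1:])"
    by (simp only: eigenvalues_def)
  also have "\<dots> = repeat_mset (CARD('n) - 1) {#of_real \<mu>#} + {#of_real (\<mu> + ?s)#}"
    by (subst proots_mult) (simp_all only: proots_power proots_linear_factor minus_minus, auto)
  finally show ?thesis by simp
qed

lemma sigma_scalar_plus_rank_one:
  fixes u v :: "real^'n::finite"
  assumes "1 \<le> k"
  shows "sigma k (\<chi> i j. (if i = j then \<mu> else 0) + u $ i * v $ j) =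
    \<mu> ^ (k - 1) * (real (CARD('n) choose k) * \<mu> +
      real ((CARD('n) - 1) choose (k - 1)) * (\<Sum>i\<in>UNIV. u $ i * v $ i))"
proof -
  obtain j where k: "k = Suc j" using assms by (cases k) auto
  obtain m where m: "CARD('n) = Suc m" using zero_less_card_finite by (metis gr0_conv_Suc)
  let ?s = "\<Sum>i\<in>UNIV. u $ i * v $ i"
  have "elem_sym (Suc j) (add_mset (of_real (\<mu> + s)) (replicate_mset m (of_real \<mu>))) =
    of_real (\<mu> ^ j * (real (Suc m choose Suc j) * \<mu> + real (m choose j) * s))" for s
    by (simp add: elem_sym_add_mset elem_sym_replicate_mset) (simp add: algebra_simps)
  from this[of ?s] show ?thesis
    unfolding sigma_def eigenvalues_scalar_plus_rank_one k m diff_Suc_1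
    by (simp only: Re_complex_of_real)
qed

section \<open>Curvature of a metric conformal to a pseudo-Euclidean one\<close>

lemma matrix_inv_eqI:
  fixes A B :: "real^'n^'n"
  assumes "A ** B = mat 1" "B ** A = mat 1"
  shows "matrix_inv A = B"
proof -
  have "A ** matrix_inv A = mat 1 \<and> matrix_inv A ** A = mat 1"
    unfolding matrix_inv_def by (rule someI_ex) (use assms in blast)
  then show ?thesis
    by (metis assms(2) matrix_mul_assoc matrix_mul_lid matrix_mul_rid)
qed

text \<open>
  The Christoffel symbol \<open>\<Gamma>\<^sup>k\<^sub>i\<^sub>j\<close> of \<open>\<delta>/\<phi>\<^sup>2\<close> as a linear expression in \<open>p\<close>, where \<open>p\<close> stands for the
  gradient of \<open>log \<phi>\<close>. Since it is linear in \<open>p\<close>, its partial derivatives are the same expression in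
  the derivatives of \<open>p\<close>; as a function of an arbitrary vector it can be contracted algebraically.
\<close>
definition conformal_christoffel ::
  "('n \<Rightarrow> real) \<Rightarrow> ('n \<Rightarrow> real) \<Rightarrow> 'n \<Rightarrow> 'n \<Rightarrow> 'n \<Rightarrow> real" where
  "conformal_christoffel \<epsilon> p k i j =
     - (p i * of_bool (j = k) + p j * of_bool (i = k) - \<epsilon> i * of_bool (i = j) * (\<epsilon> k * p k))"

lemma sum_mult_of_bool:
  fixes F :: "'n::finite \<Rightarrow> real"
  shows "(\<Sum>k\<in>UNIV. F k * of_bool (j = k)) = F j"
    and "(\<Sum>k\<in>UNIV. F k * of_bool (k = j)) = F j"
    and "(\<Sum>k\<in>UNIV. of_bool (j = k) * F k) = F j"
    and "(\<Sum>k\<in>UNIV. of_bool (k = j) * F k) = F j"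
  by (simp_all add: of_bool_def if_distrib[of "\<lambda>z. z * _"] if_distrib[of "\<lambda>z. _ * z"] cong: if_cong)

locale pseudo_euclidean_signs =
  fixes \<epsilon> :: "'n::finite \<Rightarrow> real"
  assumes sign: "\<epsilon> i = 1 \<or> \<epsilon> i = -1"
begin

lemma sign_mult_self [simp]: "\<epsilon> i * \<epsilon> i = 1" "\<epsilon> i * (\<epsilon> i * a) = a"
  using sign[of i] by auto

lemma sign_nonzero [simp]: "\<epsilon> i \<noteq> 0"
  using sign[of i] by auto

lemma pseudo_euclidean_nth: "pseudo_euclidean \<epsilon> $ i $ j = \<epsilon> i * of_bool (i = j)"
  by (simp add: pseudo_euclidean_def)

lemma scaled_pseudo_euclidean_mult_inverse:
  assumes "c \<noteq> 0"
  shows "(c *\<^sub>R pseudo_euclidean \<epsilon>) ** ((1 / c) *\<^sub>R pseudo_euclidean \<epsilon>) = mat 1"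
proof -
  have "(\<Sum>k\<in>UNIV. c * (\<epsilon> i * of_bool (i = k)) * (1 / c * (\<epsilon> k * of_bool (k = j)))) =
      (\<Sum>k\<in>UNIV. of_bool (i = k) * (\<epsilon> i * (\<epsilon> k * of_bool (k = j))))" for i j
    using assms by (intro sum.cong) auto
  then show ?thesis
    by (simp add: vec_eq_iff matrix_matrix_mult_def mat_def pseudo_euclidean_nth sum_mult_of_bool)
qed

lemma matrix_inv_scaled_pseudo_euclidean:
  assumes "c \<noteq> 0"
  shows "matrix_inv (c *\<^sub>R pseudo_euclidean \<epsilon>) = (1 / c) *\<^sub>R pseudo_euclidean \<epsilon>"
  using scaled_pseudo_euclidean_mult_inverse[of c] scaled_pseudo_euclidean_mult_inverse[of "1 / c"]
    assms
  by (intro matrix_inv_eqI) auto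

lemma matrix_inv_pseudo_euclidean: "matrix_inv (pseudo_euclidean \<epsilon>) = pseudo_euclidean \<epsilon>"
  using matrix_inv_scaled_pseudo_euclidean[of 1] by simp

lemma hessian_pseudo_euclidean:
  "hessian (\<lambda>_. pseudo_euclidean \<epsilon>) F x $ i $ j = pd i (pd j F) x"
  by (simp add: hessian_def christoffel_def)

lemma grad_norm_sq_pseudo_euclidean:
  "grad_norm_sq (\<lambda>_. pseudo_euclidean \<epsilon>) F x = (\<Sum>k\<in>UNIV. \<epsilon> k * (pd k F x)\<^sup>2)"
proof -
  have "grad_norm_sq (\<lambda>_. pseudo_euclidean \<epsilon>) F x =
      (\<Sum>i\<in>UNIV. \<Sum>j\<in>UNIV. of_bool (i = j) * (\<epsilon> i * (pd i F x * pd j F x)))"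
    by (simp add: grad_norm_sq_def matrix_inv_pseudo_euclidean pseudo_euclidean_nth mult_ac)
  then show ?thesis by (simp add: sum_mult_of_bool power2_eq_square)
qed

text \<open>
  The three contractions of \<open>\<Gamma>\<close> that turn each double sum in the Ricci tensor into single sums.
\<close>
lemma conformal_christoffel_contract_upper:
  "(\<Sum>k\<in>UNIV. conformal_christoffel \<epsilon> p k i j * F k) =
     - (p i * F j + p j * F i - \<epsilon> i * of_bool (i = j) * (\<Sum>k\<in>UNIV. \<epsilon> k * p k * F k))"
proof -
  have "(\<Sum>k\<in>UNIV. conformal_christoffel \<epsilon> p k i j * F k) =
      (\<Sum>k\<in>UNIV. - (p i * (of_bool (j = k) * F k) + p j * (of_bool (i = k) * F k)
         - \<epsilon> i * of_bool (i = j) * (\<epsilon> k * p k * F k)))"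
    by (intro sum.cong) (simp_all add: conformal_christoffel_def algebra_simps)
  then show ?thesis
    by (simp add: sum_negf sum_subtractf sum.distrib sum_distrib_left[symmetric] sum_mult_of_bool)
qed

lemma conformal_christoffel_sym:
  "conformal_christoffel \<epsilon> p k i j = conformal_christoffel \<epsilon> p k j i"
  by (auto simp: conformal_christoffel_def)

lemma conformal_christoffel_trace:
  "(\<Sum>k\<in>UNIV. conformal_christoffel \<epsilon> p k i k) = - (real CARD('n) * p i)"
proof -
  have "conformal_christoffel \<epsilon> p k i k = - p i" for k
    by (simp add: conformal_christoffel_def of_bool_def)
  then show ?thesis by simp
qed

lemma conformal_christoffel_contract_lower:
  "(\<Sum>k\<in>UNIV. \<epsilon> k * p k * conformal_christoffel \<epsilon> p l i k) =
     - (of_bool (i = l) * (\<Sum>k\<in>UNIV. \<epsilon> k * (p k)\<^sup>2))"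
proof -
  have "(\<Sum>k\<in>UNIV. \<epsilon> k * p k * conformal_christoffel \<epsilon> p l i k) =
      (\<Sum>k\<in>UNIV. - (of_bool (k = l) * (p i * \<epsilon> k * p k) + of_bool (i = l) * (\<epsilon> k * (p k)\<^sup>2)
         - of_bool (i = k) * (\<epsilon> k * \<epsilon> i * p k * (\<epsilon> l * p l))))"
    by (intro sum.cong)
      (simp_all add: conformal_christoffel_def algebra_simps power2_eq_square)
  then show ?thesis
    by (simp add: sum_negf sum_subtractf sum.distrib sum_distrib_left[symmetric] sum_mult_of_bool)
qed

text \<open>
  The two quadratic terms \<open>\<Sum> \<Gamma>\<^sup>k\<^sub>k\<^sub>l \<Gamma>\<^sup>l\<^sub>i\<^sub>j\<close> and \<open>\<Sum> \<Gamma>\<^sup>k\<^sub>j\<^sub>l \<Gamma>\<^sup>l\<^sub>i\<^sub>k\<close> of the Ricci tensor: contract over \<open>k\<close> first,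
  then over \<open>l\<close>.
\<close>
lemma conformal_christoffel_quadratic:
  "(\<Sum>k\<in>UNIV. \<Sum>l\<in>UNIV. conformal_christoffel \<epsilon> p k k l * conformal_christoffel \<epsilon> p l i j) =
     real CARD('n) * (2 * p i * p j - \<epsilon> i * of_bool (i = j) * (\<Sum>k\<in>UNIV. \<epsilon> k * (p k)\<^sup>2))"
  "(\<Sum>k\<in>UNIV. \<Sum>l\<in>UNIV. conformal_christoffel \<epsilon> p k j l * conformal_christoffel \<epsilon> p l i k) =
     (real CARD('n) + 2) * p i * p j - 2 * \<epsilon> i * of_bool (i = j) * (\<Sum>k\<in>UNIV. \<epsilon> k * (p k)\<^sup>2)"
proof -
  let ?C = "conformal_christoffel \<epsilon> p" and ?N = "\<Sum>k\<in>UNIV. \<epsilon> k * (p k)\<^sup>2"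
  have contract_p: "(\<Sum>l\<in>UNIV. p l * ?C l i j) = - (2 * p i * p j - \<epsilon> i * of_bool (i = j) * ?N)"
    using conformal_christoffel_contract_upper[of p i j p]
    by (simp add: mult_ac power2_eq_square)
  have "(\<Sum>k\<in>UNIV. \<Sum>l\<in>UNIV. ?C k k l * ?C l i j) = (\<Sum>l\<in>UNIV. (\<Sum>k\<in>UNIV. ?C k l k) * ?C l i j)"
    by (subst sum.swap) (simp add: sum_distrib_right conformal_christoffel_sym)
  also have "\<dots> = - (real CARD('n) * (\<Sum>l\<in>UNIV. p l * ?C l i j))"
    by (simp add: conformal_christoffel_trace sum_negf sum_distrib_left mult.assoc)
  finally show "(\<Sum>k\<in>UNIV. \<Sum>l\<in>UNIV. ?C k k l * ?C l i j) =
      real CARD('n) * (2 * p i * p j - \<epsilon> i * of_bool (i = j) * ?N)"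
    by (simp add: contract_p algebra_simps)
  have "(\<Sum>k\<in>UNIV. \<Sum>l\<in>UNIV. ?C k j l * ?C l i k) = (\<Sum>l\<in>UNIV. \<Sum>k\<in>UNIV. ?C k j l * ?C l i k)"
    by (rule sum.swap)
  also have "\<dots> = (\<Sum>l\<in>UNIV. - (p j * ?C l i l + p l * ?C l i j
      + of_bool (j = l) * (\<epsilon> j * of_bool (i = l) * ?N)))"
    by (intro sum.cong)
      (simp_all add: conformal_christoffel_contract_upper conformal_christoffel_contract_lower)
  also have "\<dots> = - (p j * (\<Sum>l\<in>UNIV. ?C l i l) + (\<Sum>l\<in>UNIV. p l * ?C l i j)
      + \<epsilon> j * of_bool (i = j) * ?N)"
    by (simp only: sum_negf sum.distrib sum_distrib_left[symmetric] sum_mult_of_bool)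
  also have "\<dots> = (real CARD('n) + 2) * p i * p j - 2 * \<epsilon> i * of_bool (i = j) * ?N"
    unfolding conformal_christoffel_trace contract_p
    by (cases "i = j") (simp_all add: algebra_simps)
  finally show "(\<Sum>k\<in>UNIV. \<Sum>l\<in>UNIV. ?C k j l * ?C l i k) =
      (real CARD('n) + 2) * p i * p j - 2 * \<epsilon> i * of_bool (i = j) * ?N" .
qed

end

text \<open>
  The Christoffel symbols and the Hessian involve first derivatives of \<open>\<phi>\<close>. Second derivatives enter
  with the curvature, and the lemmas about it assume that they exist and are symmetric at the point.
\<close>
locale conformal_factor = pseudo_euclidean_signs \<epsilon> for \<epsilon> :: "'n::finite \<Rightarrow> real" +
  fixes \<phi> :: "real^'n \<Rightarrow> real" and S :: "(real^'n) set"
  assumes open_domain: "open S"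
    and nonzero: "x \<in> S \<Longrightarrow> \<phi> x \<noteq> 0"
    and differentiable: "x \<in> S \<Longrightarrow> \<phi> differentiable at x"
begin

abbreviation g where "g \<equiv> conformal_metric (pseudo_euclidean \<epsilon>) \<phi>"
abbreviation dlog where "dlog x i \<equiv> pd i \<phi> x / \<phi> x"

lemma matrix_inv_conformal_metric:
  "x \<in> S \<Longrightarrow> matrix_inv (g x) = (\<phi> x)\<^sup>2 *\<^sub>R pseudo_euclidean \<epsilon>"
  using matrix_inv_scaled_pseudo_euclidean[of "1 / (\<phi> x)\<^sup>2"] nonzero[of x]
  by (simp add: conformal_metric_def)

lemma pd_conformal_metric:
  assumes "x \<in> S"
  shows "pd m (\<lambda>y. g y $ i $ j) x = - 2 * dlog x m / (\<phi> x)\<^sup>2 * (\<epsilon> i * of_bool (i = j))"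
proof -
  have "((\<lambda>u. 1 / u\<^sup>2 * e) has_real_derivative - 2 / (\<phi> x) ^ 3 * e) (at (\<phi> x))" for e
    using nonzero[OF assms]
    by (auto intro!: derivative_eq_intros simp: field_simps power2_eq_square power3_eq_cube)
  from partial_deriv_compose[where g = "\<lambda>u. 1 / u\<^sup>2 * (\<epsilon> i * of_bool (i = j))", OF this differentiable[OF assms]]
  show ?thesis
    using nonzero[OF assms]
    by (simp add: conformal_metric_def pseudo_euclidean_nth power2_eq_square power3_eq_cube mult_ac)
qed

lemma christoffel_conformal_metric:
  assumes "x \<in> S"
  shows "christoffel g k i j x = conformal_christoffel \<epsilon> (dlog x) k i j"
proof -
  have "christoffel g k i j x = (\<Sum>l\<in>UNIV. of_bool (k = l) * ((\<phi> x)\<^sup>2 * \<epsilon> k *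
        (pd i (\<lambda>y. g y $ j $ l) x + pd j (\<lambda>y. g y $ i $ l) x - pd l (\<lambda>y. g y $ i $ j) x))) / 2"
    unfolding christoffel_def
    by (simp add: matrix_inv_conformal_metric assms pseudo_euclidean_nth mult_ac)
  also have "\<dots> = (\<phi> x)\<^sup>2 * \<epsilon> k *
        (pd i (\<lambda>y. g y $ j $ k) x + pd j (\<lambda>y. g y $ i $ k) x - pd k (\<lambda>y. g y $ i $ j) x) / 2"
    by (simp add: sum_mult_of_bool)
  also have "\<dots> = conformal_christoffel \<epsilon> (dlog x) k i j"
    using nonzero[OF assms]
    by (cases "i = k"; cases "j = k"; cases "i = j")
      (auto simp: pd_conformal_metric assms conformal_christoffel_def field_simps)
  finally show ?thesis .
qed

lemma hessian_conformal_metric: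
  assumes "x \<in> S"
  shows "hessian g F x $ i $ j = pd i (pd j F) x + dlog x i * pd j F x + dlog x j * pd i F x
    - \<epsilon> i * of_bool (i = j) * (\<Sum>k\<in>UNIV. \<epsilon> k * dlog x k * pd k F x)"
  by (simp add: hessian_def christoffel_conformal_metric[OF assms]
      conformal_christoffel_contract_upper)

lemma pd_dlog:
  assumes "x \<in> S" "pd i \<phi> differentiable at x"
  shows "((\<lambda>t. dlog (x + t *\<^sub>R axis m 1) i) has_real_derivative
    pd m (pd i \<phi>) x / \<phi> x - dlog x m * dlog x i) (at 0)"
proof -
  have "((\<lambda>t. dlog (x + t *\<^sub>R axis m 1) i) has_real_derivative
      (pd m (pd i \<phi>) x * \<phi> x - pd i \<phi> x * pd m \<phi> x) / (\<phi> x * \<phi> x)) (at 0)"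
    using DERIV_divide[OF has_partial_deriv[OF assms(2), of "axis m 1"]
        has_partial_deriv[OF differentiable[OF assms(1)], of "axis m 1"]] nonzero[OF assms(1)]
    by simp
  then show ?thesis
    using nonzero[OF assms(1)] by (simp add: diff_divide_distrib mult.commute)
qed

lemma pd_christoffel_conformal_metric:
  assumes "x \<in> S" "\<And>i. pd i \<phi> differentiable at x"
  shows "pd m (christoffel g k i j) x =
    conformal_christoffel \<epsilon> (\<lambda>i. pd m (pd i \<phi>) x / \<phi> x - dlog x m * dlog x i) k i j"
proof -
  have "pd m (christoffel g k i j) x = pd m (\<lambda>y. conformal_christoffel \<epsilon> (dlog y) k i j) x"
    using open_domain assms(1) by (rule partial_deriv_cong) (rule christoffel_conformal_metric)
  also have "\<dots> = conformal_christoffel \<epsilon> (\<lambda>i. pd m (pd i \<phi>) x / \<phi> x - dlog x m * dlog x i) k i j"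
    unfolding conformal_christoffel_def
    by (rule partial_derivI)
      (intro DERIV_minus DERIV_diff DERIV_add DERIV_cmult DERIV_cmult_right pd_dlog assms)
  finally show ?thesis .
qed

text \<open>
  With \<open>p = \<nabla>\<phi>/\<phi>\<close> and \<open>P = \<nabla>p = \<nabla>\<^sup>2\<phi>/\<phi> - pp\<^sup>T\<close>, the derivative terms and the quadratic terms add up to
  \<open>(n - 2) (P + pp\<^sup>T)\<close> plus a multiple of \<open>\<delta>\<close>, and \<open>P + pp\<^sup>T = \<nabla>\<^sup>2\<phi>/\<phi>\<close>. Symmetry of \<open>\<nabla>\<^sup>2\<phi>\<close> merges
  \<open>P\<^sub>i\<^sub>j\<close> and \<open>P\<^sub>j\<^sub>i\<close>, which occur with different coefficients.
\<close>
lemma ricci_conformal_metric: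
  assumes x: "x \<in> S" and diff2: "\<And>i. pd i \<phi> differentiable at x"
    and sym: "\<And>i j. pd i (pd j \<phi>) x = pd j (pd i \<phi>) x"
  shows "ricci g x $ i $ j = (real CARD('n) - 2) * pd i (pd j \<phi>) x / \<phi> x + \<epsilon> i * of_bool (i = j) *
    ((\<Sum>k\<in>UNIV. \<epsilon> k * pd k (pd k \<phi>) x) / \<phi> x
       - (real CARD('n) - 1) * (\<Sum>k\<in>UNIV. \<epsilon> k * (dlog x k)\<^sup>2))"
proof -
  define P where "P m i = pd m (pd i \<phi>) x / \<phi> x - dlog x m * dlog x i" for m i
  have P_sym: "P j i = P i j" by (simp add: P_def sym)
  let ?p = "dlog x" and ?C = "conformal_christoffel \<epsilon>" and ?n = "real CARD('n)"
  let ?N = "\<Sum>k\<in>UNIV. \<epsilon> k * (dlog x k)\<^sup>2" and ?L = "\<Sum>k\<in>UNIV. \<epsilon> k * pd k (pd k \<phi>) x"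
  have "ricci g x $ i $ j = (\<Sum>k\<in>UNIV. ?C (P k) k i j - ?C (P j) k i k +
      (\<Sum>l\<in>UNIV. ?C ?p k k l * ?C ?p l i j - ?C ?p k j l * ?C ?p l i k))"
    unfolding ricci_def P_def
    by (simp add: christoffel_conformal_metric x pd_christoffel_conformal_metric diff2)
  also have "\<dots> = (\<Sum>k\<in>UNIV. ?C (P k) k i j) + ?n * P j i + ?n * (2 * ?p i * ?p j - \<epsilon> i * of_bool (i = j) * ?N)
      - ((?n + 2) * ?p i * ?p j - 2 * \<epsilon> i * of_bool (i = j) * ?N)"
    by (simp only: sum.distrib sum_subtractf conformal_christoffel_quadratic
        conformal_christoffel_trace)
  also have "(\<Sum>k\<in>UNIV. ?C (P k) k i j) = (\<Sum>k\<in>UNIV. - (of_bool (j = k) * P k i + of_bool (i = k) * P k j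
      - \<epsilon> i * of_bool (i = j) * (\<epsilon> k * P k k)))"
    by (simp add: conformal_christoffel_def mult_ac)
  also have "\<dots> = - (P j i + P i j - \<epsilon> i * of_bool (i = j) * (\<Sum>k\<in>UNIV. \<epsilon> k * P k k))"
    by (simp only: sum_negf sum_subtractf sum.distrib sum_distrib_left[symmetric] sum_mult_of_bool)
  also have "(\<Sum>k\<in>UNIV. \<epsilon> k * P k k) = ?L / \<phi> x - ?N"
    by (simp add: P_def sum_subtractf sum_divide_distrib right_diff_distrib power2_eq_square)
  finally have "ricci g x $ i $ j = - (P i j + P i j - \<epsilon> i * of_bool (i = j) * (?L / \<phi> x - ?N))
      + ?n * P i j + ?n * (2 * ?p i * ?p j - \<epsilon> i * of_bool (i = j) * ?N)
      - ((?n + 2) * ?p i * ?p j - 2 * \<epsilon> i * of_bool (i = j) * ?N)"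
    unfolding P_sym .
  moreover have "- (H + H - e * d * (L - N)) + n * H + n * (2 * a * b - e * d * N)
      - ((n + 2) * a * b - 2 * e * d * N) = (n - 2) * (H + a * b) + e * d * (L - (n - 1) * N)"
    for H e d L N n a b :: real
    by (simp add: algebra_simps)
  ultimately have "ricci g x $ i $ j = (?n - 2) * (P i j + ?p i * ?p j)
      + \<epsilon> i * of_bool (i = j) * (?L / \<phi> x - (?n - 1) * ?N)"
    by (simp only:)
  then show ?thesis by (simp add: P_def)
qed

text \<open>
  In dimension at least \<open>3\<close> the trace of the Ricci tensor cancels its Laplacian term, and the factor
  \<open>n - 2\<close> divides out. In dimension \<open>2\<close> the right-hand side is the definition.
\<close>
theorem schouten_conformal_metric:
  assumes x: "x \<in> S" and diff2: "\<And>i. pd i \<phi> differentiable at x"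
    and sym: "\<And>i j. pd i (pd j \<phi>) x = pd j (pd i \<phi>) x"
    and dim: "CARD('n) \<ge> 2"
  shows "schouten_conformal (pseudo_euclidean \<epsilon>) \<phi> x =
    (1 / \<phi> x) *\<^sub>R hessian (\<lambda>_. pseudo_euclidean \<epsilon>) \<phi> x
      - (grad_norm_sq (\<lambda>_. pseudo_euclidean \<epsilon>) \<phi> x / (2 * (\<phi> x)\<^sup>2)) *\<^sub>R pseudo_euclidean \<epsilon>"
proof (cases "CARD('n) = 2")
  case True
  then show ?thesis by (simp add: schouten_conformal_def)
next
  case False
  let ?n = "real CARD('n)"
  let ?N = "\<Sum>k\<in>UNIV. \<epsilon> k * (dlog x k)\<^sup>2" and ?L = "\<Sum>k\<in>UNIV. \<epsilon> k * pd k (pd k \<phi>) x"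
  have n: "?n - 2 \<noteq> 0" "?n - 1 \<noteq> 0" using False dim by auto
  note ricci = ricci_conformal_metric[OF x diff2 sym]
  have "scal g x = (\<Sum>i\<in>UNIV. \<Sum>j\<in>UNIV. of_bool (i = j) * ((\<phi> x)\<^sup>2 * \<epsilon> i * ricci g x $ i $ j))"
    unfolding scal_def by (simp add: matrix_inv_conformal_metric x pseudo_euclidean_nth mult_ac)
  also have "\<dots> = (\<phi> x)\<^sup>2 * (\<Sum>i\<in>UNIV. \<epsilon> i * ricci g x $ i $ i)"
    by (simp add: sum_mult_of_bool sum_distrib_left mult.assoc)
  also have "(\<Sum>i\<in>UNIV. \<epsilon> i * ricci g x $ i $ i) =
      (\<Sum>i\<in>UNIV. (?n - 2) / \<phi> x * (\<epsilon> i * pd i (pd i \<phi>) x) + (?L / \<phi> x - (?n - 1) * ?N))"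
    by (intro sum.cong) (simp_all add: ricci ring_distribs)
  also have "\<dots> = (?n - 2) / \<phi> x * ?L + ?n * (?L / \<phi> x - (?n - 1) * ?N)"
    by (simp only: sum.distrib sum_distrib_left[symmetric]) simp
  also have "(\<phi> x)\<^sup>2 * ((?n - 2) / \<phi> x * L + ?n * (L / \<phi> x - (?n - 1) * N)) =
      (\<phi> x)\<^sup>2 * (L / \<phi> x - ?n * N / 2) * (2 * (?n - 1))" for L N
    using nonzero[OF x] by (simp add: field_simps)
  finally have scal: "scal g x / (2 * (?n - 1)) = (\<phi> x)\<^sup>2 * (?L / \<phi> x - ?n * ?N / 2)"
    using n(2) by simp
  have "schouten g x $ i $ j = pd i (pd j \<phi>) x / \<phi> x - ?N / 2 * (\<epsilon> i * of_bool (i = j))" for i j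
  proof -
    have "schouten g x $ i $ j = 1 / (?n - 2) * (ricci g x $ i $ j
        - scal g x / (2 * (?n - 1)) * (1 / (\<phi> x)\<^sup>2 * (\<epsilon> i * of_bool (i = j))))"
      by (simp only: schouten_def conformal_metric_def vector_scaleR_component vector_minus_component
          pseudo_euclidean_nth real_scaleR_def)
    also have "scal g x / (2 * (?n - 1)) * (1 / (\<phi> x)\<^sup>2 * (\<epsilon> i * of_bool (i = j))) =
        \<epsilon> i * of_bool (i = j) * (?L / \<phi> x - ?n * ?N / 2)"
      unfolding scal using nonzero[OF x] by simp
    also have "ricci g x $ i $ j - \<epsilon> i * of_bool (i = j) * (?L / \<phi> x - ?n * ?N / 2) =
        (?n - 2) * (pd i (pd j \<phi>) x / \<phi> x)
        + \<epsilon> i * of_bool (i = j) * (?L / \<phi> x - (?n - 1) * ?N - (?L / \<phi> x - ?n * ?N / 2))"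
      unfolding ricci by (simp only: right_diff_distrib times_divide_eq_right)
    also have "?L / \<phi> x - (?n - 1) * ?N - (?L / \<phi> x - ?n * ?N / 2) = - ((?n - 2) * (?N / 2))"
      by (simp add: field_simps)
    also have "1 / c * (c * H + e * - (c * K)) = H - K * e" if "c \<noteq> 0" for c H e K :: real
      using that by (simp add: field_simps)
    note this[OF n(1)]
    finally show ?thesis .
  qed
  moreover have "?N / 2 = grad_norm_sq (\<lambda>_. pseudo_euclidean \<epsilon>) \<phi> x / (2 * (\<phi> x)\<^sup>2)"
    by (simp add: grad_norm_sq_pseudo_euclidean power_divide sum_divide_distrib[symmetric])
  ultimately show ?thesis
    using False by (simp add: schouten_conformal_def vec_eq_iff hessian_pseudo_euclidean
        pseudo_euclidean_nth)
qed

end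

section \<open>Functions of the radial variable\<close>

context pseudo_euclidean_signs
begin

lemma C_diff_on_radial:
  assumes "open S"
  shows "C_diff_on m S (radial \<epsilon>)"
proof -
  have "radial \<epsilon> = (\<lambda>x. \<Sum>i\<in>UNIV. \<epsilon> i * (x $ i * x $ i))"
    by (simp add: radial_def power2_eq_square fun_eq_iff)
  then show ?thesis
    by (simp only:) (intro C_diff_on_sum C_diff_on_mult C_diff_on_const C_diff_on_component assms)
qed

lemma differentiable_radial: "radial \<epsilon> differentiable at x"
  using C_diff_on_radial[of UNIV 1] by (simp add: differentiable_on_def)

lemma open_radial_vimage: "open T \<Longrightarrow> open (radial \<epsilon> -` T)"
  using C_diff_on_radial[of UNIV 0] by (simp add: continuous_on_open_vimage)

lemma pd_radial: "pd i (radial \<epsilon>) x = 2 * (\<epsilon> i * x $ i)"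
proof (rule partial_derivI)
  have "((\<lambda>t. radial \<epsilon> (x + t *\<^sub>R axis i 1)) has_real_derivative
      (\<Sum>k\<in>UNIV. \<epsilon> k * (2 * (x $ k * axis i 1 $ k)))) (at 0)"
    unfolding radial_def
    by (auto intro!: derivative_eq_intros sum.cong simp: mult_ac)
  also have "(\<Sum>k\<in>UNIV. \<epsilon> k * (2 * (x $ k * axis i 1 $ k))) =
      (\<Sum>k\<in>UNIV. of_bool (k = i) * (2 * (\<epsilon> k * x $ k)))"
    by (intro sum.cong) (auto simp: axis_def)
  finally show "((\<lambda>t. radial \<epsilon> (x + t *\<^sub>R axis i 1)) has_real_derivative 2 * (\<epsilon> i * x $ i)) (at 0)"
    by (simp only: sum_mult_of_bool)
qed

lemma pd_radial_compose:
  assumes "h differentiable at (radial \<epsilon> x)"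
  shows "pd i (h \<circ> radial \<epsilon>) x = 2 * (\<epsilon> i * x $ i) * deriv h (radial \<epsilon> x)"
  using partial_deriv_compose[of h "deriv h (radial \<epsilon> x)" "radial \<epsilon>" x "axis i 1"] assms
    differentiable_radial
  by (simp add: DERIV_deriv_iff_real_differentiable pd_radial o_def)

lemma pd_radial_compose_differentiable:
  assumes "open T" "\<And>t. t \<in> T \<Longrightarrow> h differentiable at t"
    and "x \<in> radial \<epsilon> -` T" "deriv h differentiable at (radial \<epsilon> x)"
  shows "pd i (h \<circ> radial \<epsilon>) differentiable at x"
proof -
  have "(\<lambda>y. deriv h (radial \<epsilon> y)) differentiable at x"
    using assms(4) differentiable_radial by (rule differentiable_compose)
  then have "(\<lambda>y. 2 * (\<epsilon> i * y $ i) * deriv h (radial \<epsilon> y)) differentiable at x"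
    by (intro differentiable_mult differentiable_const
        bounded_linear_imp_differentiable[OF bounded_linear_vec_nth])
  then show ?thesis
    unfolding differentiable_def
  proof (elim exE, intro exI)
    fix D assume D: "((\<lambda>y. 2 * (\<epsilon> i * y $ i) * deriv h (radial \<epsilon> y)) has_derivative D) (at x)"
    show "(pd i (h \<circ> radial \<epsilon>) has_derivative D) (at x)"
      by (rule has_derivative_transform_within_open[OF D open_radial_vimage[OF assms(1)] assms(3)])
        (simp add: pd_radial_compose assms(2))
  qed
qed

lemma pd_pd_radial_compose:
  assumes "open T" "\<And>t. t \<in> T \<Longrightarrow> h differentiable at t"
    and "x \<in> radial \<epsilon> -` T" "deriv h differentiable at (radial \<epsilon> x)"
  shows "pd i (pd j (h \<circ> radial \<epsilon>)) x =
    4 * (\<epsilon> i * x $ i) * (\<epsilon> j * x $ j) * deriv (deriv h) (radial \<epsilon> x)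
      + 2 * \<epsilon> i * of_bool (i = j) * deriv h (radial \<epsilon> x)"
proof -
  have "pd i (pd j (h \<circ> radial \<epsilon>)) x = pd i (\<lambda>y. (2 * \<epsilon> j) * (y $ j * (deriv h \<circ> radial \<epsilon>) y)) x"
    using open_radial_vimage[OF assms(1)] assms(3)
    by (rule partial_deriv_cong) (simp add: pd_radial_compose assms(2))
  also have "\<dots> = 2 * \<epsilon> j * (axis i 1 $ j * deriv h (radial \<epsilon> x)
      + x $ j * (2 * (\<epsilon> i * x $ i) * deriv (deriv h) (radial \<epsilon> x)))"
  proof -
    have d: "(\<lambda>y. y $ j) differentiable at x"
      by (rule bounded_linear_imp_differentiable[OF bounded_linear_vec_nth])
    have d': "(deriv h \<circ> radial \<epsilon>) differentiable at x"
      using differentiable_compose[OF assms(4) differentiable_radial] by (simp add: o_def)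
    show ?thesis
      by (subst partial_deriv_cmult[OF differentiable_mult[OF d d']], subst partial_deriv_mult[OF d d'])
        (simp only: partial_deriv_component pd_radial_compose[OF assms(4)] o_apply)
  qed
  finally show ?thesis by (auto simp: axis_def algebra_simps)
qed

text \<open>
  The flat inner product of \<open>a \<xi>\<close> and \<open>b \<xi>\<close>, where \<open>\<xi>\<^sub>k = \<epsilon>\<^sub>k x\<^sub>k\<close>; every inner product of gradients of
  radial functions has this form.
\<close>
lemma sum_sign_radial: "(\<Sum>k\<in>UNIV. \<epsilon> k * (\<epsilon> k * x $ k * a) * (\<epsilon> k * x $ k * b)) = radial \<epsilon> x * a * b"
  by (simp add: radial_def sum_distrib_left power2_eq_square mult_ac)

lemma radial_two_components:
  assumes "i \<noteq> j"
  shows "radial \<epsilon> (\<chi> k. s * of_bool (k = i) + t * of_bool (k = j)) = \<epsilon> i * s\<^sup>2 + \<epsilon> j * t\<^sup>2"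
proof -
  have "radial \<epsilon> (\<chi> k. s * of_bool (k = i) + t * of_bool (k = j)) =
      (\<Sum>k\<in>UNIV. \<epsilon> k * s\<^sup>2 * of_bool (k = i) + \<epsilon> k * t\<^sup>2 * of_bool (k = j))"
    unfolding radial_def using assms by (intro sum.cong) auto
  then show ?thesis by (simp only: sum.distrib sum_mult_of_bool)
qed

text \<open>
  If \<open>r \<noteq> 0\<close> is a value of the quadratic form, some coordinate \<open>i\<close> carries the sign of \<open>r\<close>. Spend
  \<open>\<bar>r\<bar>/4\<close> on a second coordinate \<open>j\<close>; whatever the sign of that coordinate, a positive amount
  (\<open>3\<bar>r\<bar>/4\<close> or \<open>5\<bar>r\<bar>/4\<close>) is left for the \<open>i\<close>-th one.
\<close>
lemma radial_level_off_axes: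
  assumes "r \<in> range (radial \<epsilon>)" "r \<noteq> 0" "2 \<le> CARD('n)"
  obtains x :: "real^'n" and i j where "radial \<epsilon> x = r" "i \<noteq> j" "x $ i \<noteq> 0" "x $ j \<noteq> 0"
proof -
  obtain y where y: "r = radial \<epsilon> y" using assms(1) by blast
  have "\<exists>i. \<epsilon> i = sgn r"
  proof (rule ccontr)
    assume "\<nexists>i. \<epsilon> i = sgn r"
    then have opposite: "\<epsilon> i = - sgn r" for i
      using sign[of i] assms(2) by (auto simp: sgn_if split: if_splits)
    have "radial \<epsilon> y = - sgn r * (\<Sum>i\<in>UNIV. (y $ i)\<^sup>2)"
      unfolding radial_def opposite by (simp only: sum_distrib_left)
    then have "\<bar>r\<bar> = - (\<Sum>i\<in>UNIV. (y $ i)\<^sup>2)"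
      unfolding y[symmetric] using assms(2) by (auto simp: sgn_if split: if_splits)
    moreover have "(\<Sum>i\<in>UNIV. (y $ i)\<^sup>2) \<ge> 0" by (intro sum_nonneg) simp
    ultimately show False using assms(2) by linarith
  qed
  then obtain i where i: "\<epsilon> i = sgn r" ..
  have "(UNIV :: 'n set) \<noteq> {i}"
  proof
    assume "(UNIV :: 'n set) = {i}"
    then have "CARD('n) = card {i}" by (rule arg_cong)
    with assms(3) show False by simp
  qed
  then obtain j where "j \<noteq> i" by (auto simp: set_eq_iff)
  then have j: "i \<noteq> j" by simp
  (* r is split as (r - \<epsilon> j * |r| / 4) + \<epsilon> j * |r| / 4, the two summands being carried by i and j. *)
  define t where "t = sqrt (\<bar>r\<bar> / 4)"
  define s where "s = sqrt (\<bar>r\<bar> - \<epsilon> i * \<epsilon> j * (\<bar>r\<bar> / 4))"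
  have pos: "\<bar>r\<bar> - \<epsilon> i * \<epsilon> j * (\<bar>r\<bar> / 4) > 0"
    using assms(2) sign[of i] sign[of j] by auto
  then have st: "s\<^sup>2 = \<bar>r\<bar> - \<epsilon> i * \<epsilon> j * (\<bar>r\<bar> / 4)" "t\<^sup>2 = \<bar>r\<bar> / 4"
    by (simp_all add: s_def t_def)
  have "\<epsilon> i * s\<^sup>2 + \<epsilon> j * t\<^sup>2 = \<epsilon> i * \<bar>r\<bar>"
    unfolding st by (simp add: right_diff_distrib)
  also have "\<dots> = r" by (simp add: i sgn_mult_abs)
  finally have "radial \<epsilon> (\<chi> k. s * of_bool (k = i) + t * of_bool (k = j)) = r"
    by (simp add: radial_two_components j)
  moreover have "s \<noteq> 0" "t \<noteq> 0" using pos assms(2) by (auto simp: s_def t_def)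
  ultimately show thesis using j by (intro that[of _ i j]) auto
qed

text \<open>
  Along a coordinate axis the form takes the nonzero values \<open>\<epsilon>\<^sub>i t\<^sup>2\<close>, which tend to \<open>0\<close>.
\<close>
lemma radial_zero_limit:
  assumes "open T" "0 \<in> T" "continuous_on T E" "2 \<le> CARD('n)"
    and "\<And>r. r \<in> T \<inter> range (radial \<epsilon>) \<Longrightarrow> r \<noteq> 0 \<Longrightarrow> E r = (0 :: real)"
  shows "E 0 = 0"
proof -
  fix i :: 'n
  have lim: "((\<lambda>t. \<epsilon> i * t\<^sup>2) \<longlongrightarrow> 0) (at 0)"
    by (rule tendsto_eq_intros refl | simp)+
  have "isCont E 0" using assms(1,2,3) by (simp add: continuous_on_eq_continuous_at)
  then have "((\<lambda>t. E (\<epsilon> i * t\<^sup>2)) \<longlongrightarrow> E 0) (at 0)"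
    using lim by (rule isCont_tendsto_compose)
  moreover have "((\<lambda>t. E (\<epsilon> i * t\<^sup>2)) \<longlongrightarrow> 0) (at 0)"
  proof (rule tendsto_eventually)
    have "\<forall>\<^sub>F t in at 0. \<epsilon> i * t\<^sup>2 \<in> T" using lim assms(1,2) by (rule topological_tendstoD)
    moreover have "\<forall>\<^sub>F t in at 0. t \<noteq> (0 :: real)" by (simp add: eventually_at_filter)
    ultimately show "\<forall>\<^sub>F t in at 0. E (\<epsilon> i * t\<^sup>2) = 0"
    proof eventually_elim
      case (elim t)
      have "radial \<epsilon> (axis i t) = (\<Sum>k\<in>UNIV. \<epsilon> k * t\<^sup>2 * of_bool (k = i))"
        unfolding radial_def by (intro sum.cong) (auto simp: axis_def)
      then have "radial \<epsilon> (axis i t) = \<epsilon> i * t\<^sup>2" by (simp only: sum_mult_of_bool)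
      then have "\<epsilon> i * t\<^sup>2 \<in> range (radial \<epsilon>)" by (metis rangeI)
      with elim show ?case by (intro assms(5)) auto
    qed
  qed
  ultimately show ?thesis using tendsto_unique at_neq_bot by blast
qed

text \<open>
  The separation of the coefficients of \<open>\<xi>\<xi>\<^sup>T\<close> and of \<open>\<delta>\<close>. At \<open>r = 0\<close> the origin yields the equation
  for \<open>D\<close> directly, whereas the one for \<open>E\<close> needs the limit, since \<open>\<xi>\<close> vanishes at the only point
  available when the form is definite.
\<close>
lemma radial_rank_one_equation_iff:
  assumes "open T" "continuous_on T E" "2 \<le> CARD('n)"
  shows "(\<forall>x\<in>radial \<epsilon> -` T. \<forall>i j. (\<epsilon> i * x $ i) * (\<epsilon> j * x $ j) * E (radial \<epsilon> x) =
        \<epsilon> i * of_bool (i = j) * D (radial \<epsilon> x))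
    \<longleftrightarrow> (\<forall>r\<in>T \<inter> range (radial \<epsilon>). E r = 0 \<and> D r = 0)" (is "?L \<longleftrightarrow> ?R")
proof
  assume L: ?L
  have nonzero: "E r = 0 \<and> D r = 0" if r: "r \<in> T \<inter> range (radial \<epsilon>)" "r \<noteq> 0" for r
  proof -
    have "r \<in> range (radial \<epsilon>)" using r by blast
    then obtain x :: "real^'n" and i j
      where x: "radial \<epsilon> x = r" "i \<noteq> j" "x $ i \<noteq> 0" "x $ j \<noteq> 0"
      using r(2) assms(3) by (rule radial_level_off_axes)
    then have "x \<in> radial \<epsilon> -` T" using r by auto
    then have *: "(\<epsilon> i * x $ i) * (\<epsilon> j * x $ j) * E r = \<epsilon> i * of_bool (i = j) * D r" for i j
      using L[rule_format, of x i j] unfolding x(1) by blast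
    from *[of i j] x have E: "E r = 0" by simp
    with *[of i i] show ?thesis by simp
  qed
  have zero: "E 0 = 0 \<and> D 0 = 0" if "0 \<in> T"
  proof
    show "E 0 = 0" using radial_zero_limit[OF assms(1) that assms(2,3)] nonzero by blast
    have "radial \<epsilon> 0 = 0" by (simp add: radial_def)
    with L that have "\<epsilon> i * of_bool (i = i) * D 0 = 0" for i by force
    then show "D 0 = 0" by simp
  qed
  show ?R
  proof
    fix r assume r: "r \<in> T \<inter> range (radial \<epsilon>)"
    show "E r = 0 \<and> D r = 0"
    proof (cases "r = 0")
      case True
      with r zero show ?thesis by simp
    next
      case False
      with r show ?thesis by (rule nonzero)
    qed
  qed
qed auto

end


section \<open>The soliton equation for radial conformal factors\<close>

text \<open>
  Both binomial coefficients in \<open>\<sigma>\<^sub>k\<close> are multiples of \<open>(n - 1)!/(k! (n - k)!)\<close>, which is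
  \<open>c_const n k\<close> without its power of \<open>2\<close>.
\<close>
lemma sigma_coefficients:
  assumes "1 \<le> k" "k \<le> n"
  shows "real (n choose k) = fact (n - 1) / (fact k * fact (n - k)) * real n"
    and "real ((n - 1) choose (k - 1)) = fact (n - 1) / (fact k * fact (n - k)) * real k"
proof -
  obtain j m where k: "k = Suc j" and n: "n = Suc m" using assms by (metis Suc_le_D le_trans One_nat_def)
  show "real (n choose k) = fact (n - 1) / (fact k * fact (n - k)) * real n"
    using assms(2) by (simp add: binomial_fact n field_simps)
  show "real ((n - 1) choose (k - 1)) = fact (n - 1) / (fact k * fact (n - k)) * real k"
    using assms(2) by (simp add: binomial_fact k n del: of_nat_Suc)
qed

locale radial_conformal = pseudo_euclidean_signs \<epsilon> for \<epsilon> :: "'n::finite \<Rightarrow> real" +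
  fixes \<phi> :: "real \<Rightarrow> real" and T :: "real set"
  assumes open_interval: "open T"
    and smooth_factor: "smooth_on T \<phi>"
    and factor_nonzero: "t \<in> T \<Longrightarrow> \<phi> t \<noteq> 0"
    and dimension: "2 \<le> CARD('n)"
begin

lemma smooth_on_intervalD:
  assumes "smooth_on T h"
  shows "t \<in> T \<Longrightarrow> h differentiable at t" "t \<in> T \<Longrightarrow> deriv h differentiable at t"
    "continuous_on T (deriv (deriv h))" "continuous_on T (deriv h)" "continuous_on T h"
proof -
  have "C_diff_on (Suc (Suc (Suc 0))) T h" using assms by (simp add: smooth_on_def)
  then show "t \<in> T \<Longrightarrow> h differentiable at t" "t \<in> T \<Longrightarrow> deriv h differentiable at t"
    "continuous_on T (deriv (deriv h))" "continuous_on T (deriv h)" "continuous_on T h"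
    by (auto simp: differentiable_on_eq_differentiable_at[OF open_interval]
        intro: differentiable_imp_continuous_on)
qed

lemma smooth_on_radial_compose:
  assumes "smooth_on T h"
  shows "smooth_on (radial \<epsilon> -` T) (\<lambda>x. h (radial \<epsilon> x))"
  using assms open_radial_vimage[OF open_interval] open_interval
  by (auto simp: smooth_on_def intro!: C_diff_on_compose[of _ T "radial \<epsilon>" _ h] C_diff_on_radial)

lemma differentiable_factor: "x \<in> radial \<epsilon> -` T \<Longrightarrow> (\<phi> \<circ> radial \<epsilon>) differentiable at x"
  using differentiable_compose[OF _ differentiable_radial, of \<phi>] smooth_on_intervalD(1)[OF smooth_factor]
  by (simp add: o_def)

sublocale conformal_factor \<epsilon> "\<phi> \<circ> radial \<epsilon>" "radial \<epsilon> -` T"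
  by unfold_locales (auto simp: open_radial_vimage open_interval factor_nonzero differentiable_factor)

lemma hessian_factor_sym:
  assumes "x \<in> radial \<epsilon> -` T"
  shows "pd i (\<phi> \<circ> radial \<epsilon>) differentiable at x"
    and "pd i (pd j (\<phi> \<circ> radial \<epsilon>)) x = pd j (pd i (\<phi> \<circ> radial \<epsilon>)) x"
  using assms smooth_on_intervalD[OF smooth_factor]
  by (auto simp: pd_pd_radial_compose[OF open_interval]
      intro: pd_radial_compose_differentiable[OF open_interval])

lemma schouten_radial_conformal:
  assumes "x \<in> radial \<epsilon> -` T" "r = radial \<epsilon> x"
  shows "schouten_conformal (pseudo_euclidean \<epsilon>) (\<phi> \<circ> radial \<epsilon>) x $ i $ j =
    4 * deriv (deriv \<phi>) r / \<phi> r * ((\<epsilon> i * x $ i) * (\<epsilon> j * x $ j))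
    + (2 * deriv \<phi> r / \<phi> r - 2 * r * (deriv \<phi> r)\<^sup>2 / (\<phi> r)\<^sup>2) * (\<epsilon> i * of_bool (i = j))"
proof -
  have r: "r \<in> T" and nz: "\<phi> r \<noteq> 0" using assms factor_nonzero by auto
  note smooth = smooth_on_intervalD[OF smooth_factor]
  have "grad_norm_sq (\<lambda>_. pseudo_euclidean \<epsilon>) (\<phi> \<circ> radial \<epsilon>) x =
      (\<Sum>k\<in>UNIV. \<epsilon> k * (\<epsilon> k * x $ k * (2 * deriv \<phi> r)) * (\<epsilon> k * x $ k * (2 * deriv \<phi> r)))"
    unfolding grad_norm_sq_pseudo_euclidean using smooth(1)[OF r] assms(2)
    by (intro sum.cong) (simp_all add: pd_radial_compose power2_eq_square mult_ac)
  then have grad: "grad_norm_sq (\<lambda>_. pseudo_euclidean \<epsilon>) (\<phi> \<circ> radial \<epsilon>) x = 4 * r * (deriv \<phi> r)\<^sup>2"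
    unfolding sum_sign_radial using assms(2) by (simp add: power2_eq_square)
  have hess: "pd i (pd j (\<phi> \<circ> radial \<epsilon>)) x = 4 * (\<epsilon> i * x $ i) * (\<epsilon> j * x $ j) * deriv (deriv \<phi>) r
      + 2 * \<epsilon> i * of_bool (i = j) * deriv \<phi> r"
    unfolding assms(2)
    using r assms by (intro pd_pd_radial_compose[OF open_interval smooth(1)]) (auto intro: smooth(2))
  show ?thesis
    unfolding schouten_conformal_metric[OF assms(1) hessian_factor_sym[OF assms(1)] dimension]
    using nz assms(2)
    by (simp add: hessian_pseudo_euclidean pseudo_euclidean_nth grad hess field_simps power2_eq_square)
qed

text \<open>
  With \<open>m = \<phi>\<phi>' - r \<phi>'\<^sup>2\<close>, the matrix \<open>g\<inverse>A\<close> is \<open>2m\<close> times the identity plus \<open>(4 \<phi>\<phi>'' x) \<xi>\<^sup>T\<close>. The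
  power \<open>2\<^sup>k\<^sup>-\<^sup>1\<close> in \<open>c_const\<close> comes from \<open>(2m)\<^sup>k\<^sup>-\<^sup>1\<close>.
\<close>
lemma sigma_radial_conformal:
  assumes "x \<in> radial \<epsilon> -` T" "r = radial \<epsilon> x" "1 \<le> k" "k \<le> CARD('n)"
  shows "sigma k (matrix_inv (g x) ** schouten_conformal (pseudo_euclidean \<epsilon>) (\<phi> \<circ> radial \<epsilon>) x) =
    c_const CARD('n) k * (\<phi> r * deriv \<phi> r - r * (deriv \<phi> r)\<^sup>2) ^ (k - 1) *
            (2 * real CARD('n) * \<phi> r * deriv \<phi> r - 2 * real CARD('n) * r * (deriv \<phi> r)\<^sup>2
              + 4 * real k * r * \<phi> r * deriv (deriv \<phi>) r)"
proof -
  have nz: "\<phi> r \<noteq> 0" using assms factor_nonzero by auto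
  define m where "m = \<phi> r * deriv \<phi> r - r * (deriv \<phi> r)\<^sup>2"
  define c0 :: real where "c0 = fact (CARD('n) - 1) / (fact k * fact (CARD('n) - k))"
  let ?s = "4 * \<phi> r * deriv (deriv \<phi>) r"
  let ?A = "schouten_conformal (pseudo_euclidean \<epsilon>) (\<phi> \<circ> radial \<epsilon>) x"
  have "(matrix_inv (g x) ** ?A) $ i $ j =
      (if i = j then 2 * m else 0) + (?s *\<^sub>R x) $ i * (\<chi> j. \<epsilon> j * x $ j) $ j" for i j
  proof -
    have "(matrix_inv (g x) ** ?A) $ i $ j = (\<Sum>k\<in>UNIV. of_bool (i = k) * ((\<phi> r)\<^sup>2 * \<epsilon> i * ?A $ k $ j))"
      using assms(2) by (simp add: matrix_inv_conformal_metric[OF assms(1)] matrix_matrix_mult_def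
          pseudo_euclidean_nth mult_ac)
    also have "\<dots> = (\<phi> r)\<^sup>2 * \<epsilon> i * ?A $ i $ j" by (simp only: sum_mult_of_bool)
    also have "\<dots> = (if i = j then 2 * m else 0) + (?s *\<^sub>R x) $ i * (\<chi> j. \<epsilon> j * x $ j) $ j"
      unfolding schouten_radial_conformal[OF assms(1,2)] m_def
      using nz by (auto simp: field_simps power2_eq_square)
    finally show ?thesis .
  qed
  then have "matrix_inv (g x) ** ?A =
      (\<chi> i j. (if i = j then 2 * m else 0) + (?s *\<^sub>R x) $ i * (\<chi> j. \<epsilon> j * x $ j) $ j)"
    by (simp add: vec_eq_iff)
  then have "sigma k (matrix_inv (g x) ** ?A) = (2 * m) ^ (k - 1) * (real (CARD('n) choose k) * (2 * m) +
      real ((CARD('n) - 1) choose (k - 1)) * (\<Sum>i\<in>UNIV. (?s *\<^sub>R x) $ i * (\<chi> j. \<epsilon> j * x $ j) $ i))"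
    by (simp only: sigma_scalar_plus_rank_one[OF assms(3)])
  also have "(\<Sum>i\<in>UNIV. (s *\<^sub>R x) $ i * (\<chi> j. \<epsilon> j * x $ j) $ i) = s * r" for s
    by (simp add: assms(2) radial_def sum_distrib_left power2_eq_square mult_ac)
  also have "(2 * m) ^ (k - 1) * (real (CARD('n) choose k) * (2 * m) +
      real ((CARD('n) - 1) choose (k - 1)) * (?s * r)) =
      c0 * 2 ^ (k - 1) * m ^ (k - 1) * (2 * real CARD('n) * m + real k * (?s * r))"
    unfolding sigma_coefficients[OF assms(3,4)] c0_def[symmetric]
    by (simp add: power_mult_distrib algebra_simps)
  also have "\<dots> = c_const CARD('n) k * m ^ (k - 1) * (2 * real CARD('n) * m + real k * (?s * r))"
    by (simp add: c_const_def c0_def)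
  also have "2 * real CARD('n) * m + real k * (?s * r) =
      2 * real CARD('n) * \<phi> r * deriv \<phi> r - 2 * real CARD('n) * r * (deriv \<phi> r)\<^sup>2
              + 4 * real k * r * \<phi> r * deriv (deriv \<phi>) r"
    by (simp add: m_def algebra_simps)
  finally show ?thesis unfolding m_def .
qed

lemma hessian_radial_conformal:
  assumes "x \<in> radial \<epsilon> -` T" "r = radial \<epsilon> x" "smooth_on T f"
  shows "hessian g (f \<circ> radial \<epsilon>) x $ i $ j =
    (\<epsilon> i * x $ i) * (\<epsilon> j * x $ j) * (4 * (deriv (deriv f) r + 2 * (deriv f r * deriv \<phi> r / \<phi> r)))
    + \<epsilon> i * of_bool (i = j) * (2 * deriv f r - 4 * r * deriv f r * deriv \<phi> r / \<phi> r)"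
proof -
  have r: "r \<in> T" and nz: "\<phi> r \<noteq> 0" using assms factor_nonzero by auto
  note smooth = smooth_on_intervalD[OF smooth_factor] and smooth' = smooth_on_intervalD[OF assms(3)]
  have pd\<phi>: "pd i (\<phi> \<circ> radial \<epsilon>) x = \<epsilon> i * x $ i * (2 * deriv \<phi> r)"
    and pdf: "pd i (f \<circ> radial \<epsilon>) x = \<epsilon> i * x $ i * (2 * deriv f r)" for i
    using smooth(1)[OF r] smooth'(1)[OF r] assms(2) by (simp_all add: pd_radial_compose)
  have hess: "pd i (pd j (f \<circ> radial \<epsilon>)) x = 4 * (\<epsilon> i * x $ i) * (\<epsilon> j * x $ j) * deriv (deriv f) r
      + 2 * \<epsilon> i * of_bool (i = j) * deriv f r"
    unfolding assms(2)
    using r assms by (intro pd_pd_radial_compose[OF open_interval smooth'(1)]) (auto intro: smooth'(2))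
  have "(\<Sum>k\<in>UNIV. \<epsilon> k * dlog x k * pd k (f \<circ> radial \<epsilon>) x) =
      (\<Sum>k\<in>UNIV. \<epsilon> k * (\<epsilon> k * x $ k * (2 * deriv \<phi> r / \<phi> r)) * (\<epsilon> k * x $ k * (2 * deriv f r)))"
    using assms(2) by (intro sum.cong) (simp_all add: pd\<phi> pdf)
  then have inner: "(\<Sum>k\<in>UNIV. \<epsilon> k * dlog x k * pd k (f \<circ> radial \<epsilon>) x) =
      r * (2 * deriv \<phi> r / \<phi> r) * (2 * deriv f r)"
    unfolding sum_sign_radial by (simp add: assms(2))
  have dlog: "dlog x i = \<epsilon> i * x $ i * (2 * deriv \<phi> r) / \<phi> r" for i
    using pd\<phi>[of i] assms(2) by simp
  show ?thesis
    unfolding hessian_conformal_metric[OF assms(1)] inner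
    unfolding hess dlog pdf by (simp add: algebra_simps)
qed

lemma pseudo_riemannian_radial_conformal: "pseudo_riemannian_metric (radial \<epsilon> -` T) g"
  unfolding pseudo_riemannian_metric_def
proof (intro conjI allI ballI)
  show "open (radial \<epsilon> -` T)" by (rule open_domain)
  show "smooth_on (radial \<epsilon> -` T) (\<lambda>x. g x $ i $ j)" for i j
  proof -
    have "C_diff_on m (radial \<epsilon> -` T)
        (\<lambda>x. inverse (\<phi> (radial \<epsilon> x) * \<phi> (radial \<epsilon> x)) * (\<epsilon> i * of_bool (i = j)))" for m
      using smooth_on_radial_compose[OF smooth_factor] factor_nonzero
      by (intro C_diff_on_mult C_diff_on_inverse C_diff_on_const open_domain)
        (auto simp: smooth_on_def)
    then show ?thesis
      by (simp add: smooth_on_def conformal_metric_def pseudo_euclidean_nth power2_eq_square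
          inverse_eq_divide)
  qed
  fix x assume x: "x \<in> radial \<epsilon> -` T"
  show "transpose (g x) = g x"
    by (auto simp: vec_eq_iff transpose_def conformal_metric_def pseudo_euclidean_nth)
  have c: "(\<phi> (radial \<epsilon> x))\<^sup>2 \<noteq> 0" using x factor_nonzero by simp
  show "invertible (g x)"
    unfolding invertible_def conformal_metric_def
    using scaled_pseudo_euclidean_mult_inverse[OF c]
      scaled_pseudo_euclidean_mult_inverse[of "1 / (\<phi> (radial \<epsilon> x))\<^sup>2"] c
    by (intro exI[of _ "(\<phi> (radial \<epsilon> x))\<^sup>2 *\<^sub>R pseudo_euclidean \<epsilon>"]) simp
qed

text \<open>
  Entry by entry, the soliton equation says \<open>\<xi>\<^sub>i \<xi>\<^sub>j 4E(r) = \<delta>\<^sub>i\<^sub>j D(r)\<close>, where \<open>E\<close> is the left-hand side of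
  the first equation and \<open>D\<close> is a nonzero multiple of the difference of the two sides of the second.
\<close>
theorem gradient_k_yamabe_soliton_radial_iff:
  assumes f: "smooth_on T f" and k: "1 \<le> k" "k \<le> CARD('n)"
  defines "n \<equiv> CARD('n)"
  shows "gradient_k_yamabe_soliton (radial \<epsilon> -` T) g
      (schouten_conformal (pseudo_euclidean \<epsilon>) (\<phi> \<circ> radial \<epsilon>)) k (f \<circ> radial \<epsilon>) lam
    \<longleftrightarrow>
    (\<forall>r \<in> T \<inter> range (radial \<epsilon>).
        deriv (deriv f) r + 2 * (deriv f r * deriv \<phi> r / \<phi> r) = 0 \<and>
        c_const n k * (\<phi> r * deriv \<phi> r - r * (deriv \<phi> r)\<^sup>2) ^ (k - 1) *
            (2 * real n * \<phi> r * deriv \<phi> r - 2 * real n * r * (deriv \<phi> r)\<^sup>2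
              + 4 * real k * r * \<phi> r * deriv (deriv \<phi>) r)
          - (\<phi> r)\<^sup>2 * deriv f r / (real n - 1)
          + 2 * r * deriv f r * deriv \<phi> r * \<phi> r / (real n - 1) = lam)"
    (is "_ \<longleftrightarrow> (\<forall>r\<in>_. ?E r = 0 \<and> ?S r - ?F r + ?G r = lam)")
proof -
  let ?A = "schouten_conformal (pseudo_euclidean \<epsilon>) (\<phi> \<circ> radial \<epsilon>)"
  define B where "B r = 2 * deriv f r - 4 * r * deriv f r * deriv \<phi> r / \<phi> r" for r
  define D where "D r = 2 * (real n - 1) * (?S r - lam) / (\<phi> r)\<^sup>2 - B r" for r
  have n: "real n - 1 > 0" using dimension by (simp add: n_def)
  have four: "4 * e = 0 \<longleftrightarrow> e = 0" for e :: real by simp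
  have D_iff: "D r = 0 \<longleftrightarrow> ?S r - ?F r + ?G r = lam" if "r \<in> T" for r
  proof -
    have nz: "\<phi> r \<noteq> 0" using factor_nonzero that by simp
    have "u\<^sup>2 * p / c - 2 * r * p * q * u / c = u\<^sup>2 * (2 * p - 4 * r * p * q / u) / (2 * c)"
      if "c \<noteq> 0" "u \<noteq> 0" for c u p q :: real
      using that by (simp add: field_simps power2_eq_square)
    then have balance: "?F r - ?G r = (\<phi> r)\<^sup>2 * B r / (2 * (real n - 1))"
      unfolding B_def using n nz by simp
    have solve: "2 * c * (s - lam) / u\<^sup>2 - w = 0 \<longleftrightarrow> s - lam = u\<^sup>2 * w / (2 * c)"
      if "c \<noteq> 0" "u \<noteq> 0" for c u s w :: real
      using that by (auto simp: field_simps)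
    have "D r = 0 \<longleftrightarrow> ?S r - lam = (\<phi> r)\<^sup>2 * B r / (2 * (real n - 1))"
      unfolding D_def by (rule solve) (use n nz in auto)
    with balance show ?thesis by linarith
  qed
  have "gradient_k_yamabe_soliton (radial \<epsilon> -` T) g ?A k (f \<circ> radial \<epsilon>) lam \<longleftrightarrow>
      (\<forall>x\<in>radial \<epsilon> -` T. \<forall>i j. (\<epsilon> i * x $ i) * (\<epsilon> j * x $ j) * (4 * ?E (radial \<epsilon> x)) =
        \<epsilon> i * of_bool (i = j) * D (radial \<epsilon> x))"
  proof -
    have eq: "hessian g (f \<circ> radial \<epsilon>) x $ i $ j =
          ((2 * (real CARD('n) - 1) * (sigma k (matrix_inv (g x) ** ?A x) - lam)) *\<^sub>R g x) $ i $ j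
        \<longleftrightarrow> (\<epsilon> i * x $ i) * (\<epsilon> j * x $ j) * (4 * ?E (radial \<epsilon> x)) =
          \<epsilon> i * of_bool (i = j) * D (radial \<epsilon> x)"
      if x: "x \<in> radial \<epsilon> -` T" for x i j
    proof -
      have "((2 * (real CARD('n) - 1) * (sigma k (matrix_inv (g x) ** ?A x) - lam)) *\<^sub>R g x) $ i $ j =
          \<epsilon> i * of_bool (i = j) * (2 * (real n - 1) * (?S (radial \<epsilon> x) - lam) / (\<phi> (radial \<epsilon> x))\<^sup>2)"
        unfolding sigma_radial_conformal[OF x refl k] n_def
        by (simp add: conformal_metric_def pseudo_euclidean_nth)
      moreover have "hessian g (f \<circ> radial \<epsilon>) x $ i $ j =
          (\<epsilon> i * x $ i) * (\<epsilon> j * x $ j) * (4 * ?E (radial \<epsilon> x)) + \<epsilon> i * of_bool (i = j) * B (radial \<epsilon> x)"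
        unfolding hessian_radial_conformal[OF x refl f] B_def ..
      ultimately show ?thesis
        unfolding D_def right_diff_distrib by linarith
    qed
    have "smooth_on (radial \<epsilon> -` T) (f \<circ> radial \<epsilon>)"
      using smooth_on_radial_compose[OF f] by (simp add: o_def)
    then show ?thesis
      unfolding gradient_k_yamabe_soliton_def
      using pseudo_riemannian_radial_conformal eq by (simp only: vec_eq_iff simp_thms cong: ball_cong)
  qed
  also have "\<dots> \<longleftrightarrow> (\<forall>r\<in>T \<inter> range (radial \<epsilon>). 4 * ?E r = 0 \<and> D r = 0)"
    using open_interval _ dimension
  proof (rule radial_rank_one_equation_iff)
    show "continuous_on T (\<lambda>r. 4 * ?E r)"
      using smooth_on_intervalD[OF f] smooth_on_intervalD[OF smooth_factor] factor_nonzero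
      by (intro continuous_intros) auto
  qed
  also have "\<dots> \<longleftrightarrow> (\<forall>r\<in>T \<inter> range (radial \<epsilon>). ?E r = 0 \<and> ?S r - ?F r + ?G r = lam)"
    unfolding four by (intro ball_cong refl conj_cong D_iff) blast
  finally show ?thesis .
qed

end

theorem theorem1p6:
  fixes \<epsilon> :: "'n::finite \<Rightarrow> real" and \<phi> f :: "real \<Rightarrow> real"
    and a b :: ereal and k n :: nat and lam :: real
  assumes n: "n = CARD('n)" "n \<ge> 2"
    and k: "1 \<le> k" "k \<le> n"
    and \<epsilon>: "\<And>i. \<epsilon> i = 1 \<or> \<epsilon> i = -1"
    and smooth: "smooth_on (einterval a b) \<phi>" "smooth_on (einterval a b) f"
    and pos: "\<And>t. t \<in> einterval a b \<Longrightarrow> \<phi> t > 0"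
  shows "gradient_k_yamabe_soliton (radial \<epsilon> -` einterval a b)
           (conformal_metric (pseudo_euclidean \<epsilon>) (\<phi> \<circ> radial \<epsilon>))
           (schouten_conformal (pseudo_euclidean \<epsilon>) (\<phi> \<circ> radial \<epsilon>)) k (f \<circ> radial \<epsilon>) lam
     \<longleftrightarrow>
     (\<forall>r \<in> einterval a b \<inter> range (radial \<epsilon>).
        deriv (deriv f) r + 2 * (deriv f r * deriv \<phi> r / \<phi> r) = 0 \<and>
        c_const n k * (\<phi> r * deriv \<phi> r - r * (deriv \<phi> r)\<^sup>2) ^ (k - 1) *
            (2 * real n * \<phi> r * deriv \<phi> r - 2 * real n * r * (deriv \<phi> r)\<^sup>2
              + 4 * real k * r * \<phi> r * deriv (deriv \<phi>) r)
          - (\<phi> r)\<^sup>2 * deriv f r / (real n - 1)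
          + 2 * r * deriv f r * deriv \<phi> r * \<phi> r / (real n - 1) = lam)"
proof -
  interpret radial_conformal \<epsilon> \<phi> "einterval a b"
  proof unfold_locales
    show "\<phi> t \<noteq> 0" if "t \<in> einterval a b" for t
      using pos[OF that] by simp
  qed (use n \<epsilon> smooth in auto)
  show ?thesis
    using gradient_k_yamabe_soliton_radial_iff[OF smooth(2) k(1)] k(2) n(1) by simp
qed

end
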